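(* Let $q$ be a prime power with $q\equiv 1\pmod 4$. A conference graph with parameters $(q,(q-1)/2,(q-5)/4,(q-1)/4)$ yields a binary even LCD code if and only if $q\equiv 1\pmod 8$. Furthermore, the codes yielded by such conference graphs (for $q\equiv 1 \pmod 8$) have length $q$ and dimension $(q-1)/2$, and two such codes are permutation equivalent if and only if the corresponding conference graphs are isomorphic.
   Context: A strongly regular graph with parameters $(v,k,\lambda,\mu)$ is a simple $k$-regular graph on $v$ vertices in which any two adjacent vertices have exactly $\lambda$ common neighbours and any two distinct non-adjacent vertices have exactly $\mu$ common neighbours. A conference graph is a strongly regular graph with parameters $(q,(q-1)/2,(q-5)/4,(q-1)/4)$, where $q$ is a prime power with $q\equiv 1\pmod 4$. A binary code of length $n$ is a linear subspace $C\subseteq\mathbb{F}_2^n$ (the zero code is allowed). Its dual $C^\perp$ is taken with respect to $\langle x,y\rangle=\sum_i x_iy_i$. $C$ is LCD (linear complementary dual) if $C\cap C^\perp=\{0\}$, equivalently $\mathbb{F}_2^n=C\oplus C^\perp$. $C$ is even if every codeword has even Hamming weight. Two codes $C_1,C_2\subseteq\mathbb{F}_2^n$ are permutation equivalent if $C_2=\{cP:c\in C_1\}$ for some permutation matrix $P$. For an LCD code $C$, the orthogonal projector $\Pi_C$ is the unique $n\times n$ matrix over $\mathbb{F}_2$ with $v\Pi_C=v$ for all row vectors $v\in C$ and $v\Pi_C=0$ for all $v\in C^\perp$. A finite simple graph on $n$ (ordered) vertices with adjacency matrix $A$ is said to yield a binary even LCD code if $A$, read over $\mathbb{F}_2$,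 equals $\Pi_C$ for some binary even LCD code $C$ of length $n$; this $C$ (which is the row span of $A$ over $\mathbb{F}_2$) is the code yielded by the graph. *)

theory Defs
  imports
    "HOL-Library.Z2"
    "HOL-Number_Theory.Prime_Powers"
    "HOL-Combinatorics.Permutations"
    "Graph_Theory.Digraph_Isomorphism"
    "Graph_Theory.Pair_Digraph"
    "Jordan_Normal_Form.DL_Rank"
begin

definition neighbours :: "'a pair_pre_digraph \<Rightarrow> 'a \<Rightarrow> 'a set" where
  "neighbours G x = {y \<in> pverts G. (x, y) \<in> parcs G}"

text \<open>The locale \<^locale>\<open>pair_graph\<close> describes the finite simple graphs: the arc relation is
  symmetric and irreflexive.\<close>

definition strongly_regular_graph ::
  "nat \<Rightarrow> nat \<Rightarrow> nat \<Rightarrow> nat \<Rightarrow> 'a pair_pre_digraph \<Rightarrow> bool" where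
  "strongly_regular_graph v k l m G \<longleftrightarrow>
     pair_graph G \<and>
     card (pverts G) = v \<and>
     (\<forall>x\<in>pverts G. card (neighbours G x) = k) \<and>
     (\<forall>x\<in>pverts G. \<forall>y\<in>pverts G. (x, y) \<in> parcs G \<longrightarrow>
        card (neighbours G x \<inter> neighbours G y) = l) \<and>
     (\<forall>x\<in>pverts G. \<forall>y\<in>pverts G. x \<noteq> y \<and> (x, y) \<notin> parcs G \<longrightarrow>
        card (neighbours G x \<inter> neighbours G y) = m)"

text \<open>A prime power that is 1 modulo 4 is at least 5, so no subtraction below truncates and
  all divisions are exact.\<close>

definition conference_graph :: "nat \<Rightarrow> 'a pair_pre_digraph \<Rightarrow> bool" where
  "conference_graph q G \<longleftrightarrow>
     primepow q \<and> q mod 4 = 1 \<and>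
     strongly_regular_graph q ((q - 1) div 2) ((q - 5) div 4) ((q - 1) div 4) G"

definition vertex_ordering :: "'a pair_pre_digraph \<Rightarrow> 'a list \<Rightarrow> bool" where
  "vertex_ordering G vs \<longleftrightarrow> distinct vs \<and> set vs = pverts G"

definition adjacency_mat :: "'a pair_pre_digraph \<Rightarrow> 'a list \<Rightarrow> 'r::zero_neq_one mat" where
  "adjacency_mat G vs =
     mat (length vs) (length vs) (\<lambda>(i, j). if (vs ! i, vs ! j) \<in> parcs G then 1 else 0)"

definition binary_code :: "nat \<Rightarrow> bit vec set \<Rightarrow> bool" where
  "binary_code n C \<longleftrightarrow> subspace class_ring C (module_vec TYPE(bit) n)"

definition code_dim :: "nat \<Rightarrow> bit vec set \<Rightarrow> nat" where
  "code_dim n C = vectorspace.dim class_ring ((module_vec TYPE(bit) n)\<lparr>carrier := C\<rparr>)"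

abbreviation dual_code :: "nat \<Rightarrow> bit vec set \<Rightarrow> bit vec set" where
  "dual_code n C \<equiv> vec_module.orthogonal_complement n C"

definition LCD_code :: "nat \<Rightarrow> bit vec set \<Rightarrow> bool" where
  "LCD_code n C \<longleftrightarrow> binary_code n C \<and> C \<inter> dual_code n C = {0\<^sub>v n}"

definition hamming_weight :: "bit vec \<Rightarrow> nat" where
  "hamming_weight x = card {i. i < dim_vec x \<and> x $ i \<noteq> 0}"

definition even_code :: "bit vec set \<Rightarrow> bool" where
  "even_code C \<longleftrightarrow> (\<forall>x\<in>C. even (hamming_weight x))"

text \<open>A \<^typ>\<open>bit vec\<close> is neither a row nor a column, so the product of a row vector and a
  matrix is expressed through the transpose.\<close>

definition row_vec_mult :: "bit vec \<Rightarrow> bit mat \<Rightarrow> bit vec" where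
  "row_vec_mult v M = transpose_mat M *\<^sub>v v"

definition permutation_matrix :: "nat \<Rightarrow> bit mat \<Rightarrow> bool" where
  "permutation_matrix n P \<longleftrightarrow>
     (\<exists>p. p permutes {..<n} \<and> P = mat n n (\<lambda>(i, j). if j = p i then 1 else 0))"

definition permutation_equivalent :: "nat \<Rightarrow> bit vec set \<Rightarrow> bit vec set \<Rightarrow> bool" where
  "permutation_equivalent n C D \<longleftrightarrow>
     (\<exists>P. permutation_matrix n P \<and> D = {row_vec_mult c P | c. c \<in> C})"

text \<open>Existence and uniqueness of the described matrix hold for LCD codes only, because they
  need the decomposition of the whole space into the code and its dual.\<close>

definition orthogonal_projector :: "nat \<Rightarrow> bit vec set \<Rightarrow> bit mat" where
  "orthogonal_projector n C =
     (THE M. M \<in> carrier_mat n n \<and>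
        (\<forall>v\<in>C. row_vec_mult v M = v) \<and>
        (\<forall>v\<in>dual_code n C. row_vec_mult v M = 0\<^sub>v n))"

definition yields_code :: "'a pair_pre_digraph \<Rightarrow> 'a list \<Rightarrow> bit vec set \<Rightarrow> bool" where
  "yields_code G vs C \<longleftrightarrow>
     LCD_code (length vs) C \<and> even_code C \<and>
     adjacency_mat G vs = orthogonal_projector (length vs) C"

definition yields_even_LCD_code :: "'a pair_pre_digraph \<Rightarrow> 'a list \<Rightarrow> bool" where
  "yields_even_LCD_code G vs \<longleftrightarrow> (\<exists>C. yields_code G vs C)"

end

theory Submission
  imports Defs "Jordan_Normal_Form.Schur_Decomposition"
begin

text \<open>Write \<open>q = 4 m + 1\<close>. The adjacency matrix satisfies \<open>A\<^sup>2 = m (I + J) - A\<close>, so modulo 2 it is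
  idempotent if and only if \<open>m\<close> is even; a symmetric idempotent matrix is the orthogonal projector
  onto its fixed vectors. For the dimension, an idempotent of rank \<open>r\<close> factors as \<open>X Y\<close> with
  \<open>Y X = I\<close>, so \<open>r\<close> is the multiplicity of the root 1 of its characteristic polynomial. Over the
  complex numbers the characteristic polynomial of \<open>A\<close> is \<open>(x - 2 m) (x\<^sup>2 + x - m)\<^sup>2\<^sup>m\<close>; it has
  integer coefficients, and modulo 2 with \<open>m\<close> even it becomes \<open>x\<^sup>2\<^sup>m\<^sup>+\<^sup>1 (x + 1)\<^sup>2\<^sup>m\<close>. Finally, code
  and projector determine each other, so a coordinate permutation carries one code to the other
  exactly when it carries one adjacency matrix to the other.\<close>

section \<open>Orthogonal projectors of LCD codes\<close>

lemma of_nat_bit_eq_0_iff: "(of_nat k :: bit) = 0 \<longleftrightarrow> even k"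
proof (cases "even k")
  case True
  then obtain l where k: "k = 2 * l" by blast
  show ?thesis using True unfolding k of_nat_mult of_nat_numeral bit_2_eq_0 mult_zero_left by simp
next
  case False
  then obtain l where k: "k = 2 * l + 1" by (rule oddE)
  show ?thesis
    using False unfolding k of_nat_add of_nat_1 of_nat_mult of_nat_numeral bit_2_eq_0 mult_zero_left by simp
qed

text \<open>Every element of F_2 is its own square, so the sum counts the nonzero coordinates modulo
  2. A codeword is thus even exactly when it is orthogonal to itself.\<close>

lemma scalar_prod_self_bit: "(x :: bit vec) \<bullet> x = of_nat (hamming_weight x)"
proof -
  have "x \<bullet> x = (\<Sum>i<dim_vec x. if x $ i \<noteq> 0 then 1 else 0)"
    unfolding scalar_prod_def lessThan_atLeast0[symmetric] by (intro sum.cong) auto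
  then show ?thesis by (simp add: hamming_weight_def sum.If_cases Int_def)
qed

text \<open>Independent subsets of \<open>C\<close> have at most \<open>n\<close> elements, so a
  maximal one exists, and maximality forces it to span \<open>C\<close>. Its elements become the
  columns of \<open>X\<close>, which turns membership in \<open>C\<close> into a matrix
  equation.\<close>

lemma (in vec_space) subspace_basis_matrix:
  assumes C: "subspace class_ring C V"
  obtains r X where "X \<in> carrier_mat n r" "C = (\<lambda>y. X *\<^sub>v y) ` carrier_vec r"
    "\<And>y. y \<in> carrier_vec r \<Longrightarrow> X *\<^sub>v y = 0\<^sub>v n \<Longrightarrow> y = 0\<^sub>v r"
    "vectorspace.dim class_ring (V\<lparr>carrier := C\<rparr>) = r"
proof -
  have sub: "submodule class_ring C V" using C by (simp add: subspace_def)
  have CV: "C \<subseteq> carrier_vec n" using submodule.subset[OF sub] by simp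
  let ?P = "\<lambda>U. U \<subseteq> C \<and> lin_indpt U"
  have bound: "finite U \<and> card U \<le> n" if "?P U" for U
    using that CV li_le_dim[OF fin_dim, of U] fin_dim_li_fin[OF fin_dim, of U] dim_is_n by auto
  have empty: "?P {}" by (metis empty_subsetI fin_dim finite_basis_exists subset_li_is_li basis_def)
  obtain U where U: "maximal U ?P"
    using maximal_exists[of ?P n "{}"] bound empty by blast
  then have UC: "U \<subseteq> C" and li: "lin_indpt U" by (auto simp: maximal_def)
  have finU: "finite U" using bound UC li by blast
  have UV: "U \<subseteq> carrier_vec n" using UC CV by auto
  have span: "span U = C"
  proof
    show "span U \<subseteq> C" by (rule span_is_subset[OF UC sub])
    show "C \<subseteq> span U"
    proof
      fix v assume v: "v \<in> C"
      show "v \<in> span U"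
      proof (rule ccontr)
        assume n: "v \<notin> span U"
        then have "v \<notin> U" using UV span_mem by auto
        moreover have "lin_indpt (U \<union> {v})"
          using lin_dep_iff_in_span[of U v] UV li v CV n \<open>v \<notin> U\<close> by auto
        ultimately show False using U v UC unfolding maximal_def by blast
      qed
    qed
  qed
  have vs: "vectorspace class_ring (V\<lparr>carrier := C\<rparr>)" by (rule subspace_is_vs[OF C])
  \<comment> \<open>The dimension is taken in the space with carrier restricted to \<open>C\<close>,
    so independence and span are transferred there from the ambient space.\<close>
  have "vectorspace.basis class_ring (V\<lparr>carrier := C\<rparr>) U"
    unfolding vectorspace.basis_def[OF vs]
    using span_li_not_depend[OF UC sub] span li UC by simp
  then have dim: "vectorspace.dim class_ring (V\<lparr>carrier := C\<rparr>) = card U"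
    using vectorspace.dim_basis[OF vs finU] by blast
  obtain us where us: "set us = U" "distinct us" using finite_distinct_list[OF finU] by auto
  have len: "length us = card U" using us distinct_card by fastforce
  define X where "X = mat_of_cols n us"
  have X: "X \<in> carrier_mat n (card U)" by (simp add: X_def len[symmetric])
  have cols: "cols X = us" using cols_mat_of_cols[of us n] us(1) UV by (simp add: X_def)
  have 2: "C = (\<lambda>y. X *\<^sub>v y) ` carrier_vec (card U)"
  proof -
    have "C = {lincomb a U | a. a \<in> U \<rightarrow> UNIV}" using finite_span[OF finU, simplified, OF UV] span by simp
    also have "\<dots> = (\<lambda>y. X *\<^sub>v y) ` carrier_vec (card U)"
    proof safe
      fix a
      show "lincomb a U \<in> (\<lambda>y. X *\<^sub>v y) ` carrier_vec (card U)"
        using mat_mult_eq_lincomb[OF X, of a] us cols by (intro image_eqI[of _ _ "vec (card U) (\<lambda>i. a (col X i))"]) auto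
    next
      fix y :: "'a vec" assume "y \<in> carrier_vec (card U)"
      then show "\<exists>a. X *\<^sub>v y = lincomb a U \<and> a \<in> U \<rightarrow> UNIV"
        using lincomb_eq_mat_mult[OF X, of y] us cols by (metis Pi_UNIV UNIV_I)
    qed
    finally show ?thesis .
  qed
  have 3: "y = 0\<^sub>v (card U)" if "y \<in> carrier_vec (card U)" "X *\<^sub>v y = 0\<^sub>v n" for y
    using lin_depI[OF X that(1) _ that(2)] cols us li by auto
  show ?thesis by (rule that[OF X 2 3 dim])
qed

lemma mat_mult_unit_vec:
  fixes M :: "'a :: semiring_1 mat"
  assumes "M \<in> carrier_mat n m" "j < m"
  shows "M *\<^sub>v unit_vec m j = col M j"
  using assms by (intro eq_vecI) (auto simp: scalar_prod_right_unit)

lemma mat_eq_by_mult_vec: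
  fixes M N :: "'a :: semiring_1 mat"
  assumes M: "M \<in> carrier_mat n m" and N: "N \<in> carrier_mat n m"
    and eq: "\<And>v. v \<in> carrier_vec m \<Longrightarrow> M *\<^sub>v v = N *\<^sub>v v"
  shows "M = N"
proof (rule eq_matI)
  fix i j assume "i < dim_row N" "j < dim_col N"
  then have "col M j = col N j"
    using eq[of "unit_vec m j"] mat_mult_unit_vec[OF M] mat_mult_unit_vec[OF N] N by auto
  then show "M $$ (i, j) = N $$ (i, j)"
    using M N \<open>i < dim_row N\<close> \<open>j < dim_col N\<close> by (metis carrier_matD index_col)
qed (use M N in auto)

lemma dual_code_iff:
  "x \<in> dual_code n C \<longleftrightarrow> x \<in> carrier_vec n \<and> (\<forall>y\<in>C. x \<bullet> y = 0)"
  by (simp add: vec_module.orthogonal_complement_def)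

lemma LCD_code_carrier:
  assumes "LCD_code n C"
  shows "C \<subseteq> carrier_vec n"
  using assms submodule.subset unfolding LCD_code_def binary_code_def subspace_def
  by (metis module_vec_simps(3))

text \<open>This is the predicate under the definite description in
  \<open>orthogonal_projector\<close>; naming it separates existence and uniqueness from the
  description.\<close>

definition projects_onto :: "nat \<Rightarrow> bit mat \<Rightarrow> bit vec set \<Rightarrow> bool" where
  "projects_onto n M C \<longleftrightarrow> M \<in> carrier_mat n n \<and>
     (\<forall>v\<in>C. row_vec_mult v M = v) \<and> (\<forall>v\<in>dual_code n C. row_vec_mult v M = 0\<^sub>v n)"

text \<open>If the columns of \<open>X\<close> form a basis of an LCD code, the Gram matrix \<open>X\<^sup>T X\<close> is invertible and
  \<open>Y = (X\<^sup>T X)\<^sup>-\<^sup>1 X\<^sup>T\<close>.\<close>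

lemma LCD_code_factorization:
  assumes LCD: "LCD_code n C"
  obtains X r Y where "X \<in> carrier_mat n r" "Y \<in> carrier_mat r n" "Y * X = 1\<^sub>m r"
    "projects_onto n (X * Y)\<^sup>T C"
    "\<forall>v\<in>carrier_vec n. (X * Y) *\<^sub>v v \<in> C \<and> v - (X * Y) *\<^sub>v v \<in> dual_code n C"
    "code_dim n C = r"
proof -
  interpret vec_space "TYPE(bit)" n .
  have "subspace class_ring C V" using LCD by (simp add: LCD_code_def binary_code_def)
  then obtain r X where X: "X \<in> carrier_mat n r" and C: "C = (\<lambda>y. X *\<^sub>v y) ` carrier_vec r"
    and inj: "\<And>y. y \<in> carrier_vec r \<Longrightarrow> X *\<^sub>v y = 0\<^sub>v n \<Longrightarrow> y = 0\<^sub>v r"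
    and dim: "vectorspace.dim class_ring (V\<lparr>carrier := C\<rparr>) = r"
    using subspace_basis_matrix by metis
  \<comment> \<open>The dual code is the kernel of \<open>X\<^sup>T\<close>: orthogonality to all
    \<open>X *\<^sub>v y\<close> can be tested on unit vectors \<open>y\<close>, that is, on the
    columns of \<open>X\<close>.\<close>
  have dual: "v \<in> dual_code n C \<longleftrightarrow> v \<in> carrier_vec n \<and> X\<^sup>T *\<^sub>v v = 0\<^sub>v r" for v
  proof -
    have "X\<^sup>T *\<^sub>v v = 0\<^sub>v r \<longleftrightarrow> (\<forall>y\<in>carrier_vec r. v \<bullet> (X *\<^sub>v y) = 0)" if v: "v \<in> carrier_vec n"
    proof
      assume "X\<^sup>T *\<^sub>v v = 0\<^sub>v r"
      then show "\<forall>y\<in>carrier_vec r. v \<bullet> (X *\<^sub>v y) = 0"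
        using transpose_vec_mult_scalar[OF X _ v] by (metis scalar_prod_left_zero)
    next
      assume orth: "\<forall>y\<in>carrier_vec r. v \<bullet> (X *\<^sub>v y) = 0"
      show "X\<^sup>T *\<^sub>v v = 0\<^sub>v r"
      proof (rule eq_vecI)
        fix i assume i: "i < dim_vec (0\<^sub>v r :: bit vec)"
        have "(X\<^sup>T *\<^sub>v v) \<bullet> unit_vec r i = 0"
          using transpose_vec_mult_scalar[OF X _ v] orth by simp
        then show "(X\<^sup>T *\<^sub>v v) $ i = 0\<^sub>v r $ i"
          using i X scalar_prod_right_unit[of i r "X\<^sup>T *\<^sub>v v"] by (auto simp del: scalar_prod_right_unit)
      qed (use X in auto)
    qed
    then show ?thesis unfolding dual_code_iff C by auto
  qed
  define G where "G = X\<^sup>T * X"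
  have G: "G \<in> carrier_mat r r" using X by (simp add: G_def)
  have Xt: "X\<^sup>T \<in> carrier_mat r n" using X by simp
  \<comment> \<open>A null vector \<open>y\<close> of the Gram matrix gives
    \<open>X *\<^sub>v y\<close> in both \<open>C\<close> and its dual. The LCD property makes this
    vector zero, contradicting injectivity of \<open>X\<close>.\<close>
  have "det G \<noteq> 0"
  proof
    assume "det G = 0"
    then obtain y where y: "y \<in> carrier_vec r" "y \<noteq> 0\<^sub>v r" "G *\<^sub>v y = 0\<^sub>v r"
      using det_0_iff_vec_prod_zero_field[OF G] by blast
    have "X *\<^sub>v y \<in> dual_code n C" using y X by (auto simp: dual G_def)
    moreover have "X *\<^sub>v y \<in> C" using y C by auto
    ultimately have "X *\<^sub>v y = 0\<^sub>v n" using LCD by (auto simp: LCD_code_def)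
    then show False using inj y by blast
  qed
  from det_non_zero_imp_unit[OF G this, of "()"] obtain H where H: "H \<in> carrier_mat r r" "H * G = 1\<^sub>m r"
    by (auto simp: Units_def ring_mat_def)
  define Y where "Y = H * X\<^sup>T"
  have Y: "Y \<in> carrier_mat r n" using H X by (simp add: Y_def)
  have YX: "Y * X = 1\<^sub>m r" using H X by (simp add: Y_def G_def)
  have XYv: "(X * Y) *\<^sub>v v = X *\<^sub>v (Y *\<^sub>v v)" if "v \<in> carrier_vec n" for v
    using X Y that by simp
  have 4: "(X * Y) *\<^sub>v v = v" if v: "v \<in> C" for v
  proof -
    obtain y where y: "v = X *\<^sub>v y" "y \<in> carrier_vec r" using v C by auto
    have "(X * Y) *\<^sub>v v = X *\<^sub>v ((Y * X) *\<^sub>v y)" using X Y y by simp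
    then show ?thesis using y YX by simp
  qed
  have 5: "(X * Y) *\<^sub>v v = 0\<^sub>v n" if "v \<in> dual_code n C" for v
  proof -
    have "Y *\<^sub>v v = H *\<^sub>v (X\<^sup>T *\<^sub>v v)" using H X that by (simp add: Y_def dual)
    also have "\<dots> = 0\<^sub>v r" using H that by (intro eq_vecI) (auto simp: dual)
    finally show ?thesis using X that by (intro eq_vecI) (auto simp: XYv dual)
  qed
  have 6: "(X * Y) *\<^sub>v v \<in> C" if "v \<in> carrier_vec n" for v
    using that X Y unfolding C by (subst XYv) auto
  \<comment> \<open>\<open>G * Y = X\<^sup>T\<close> says that \<open>X\<^sup>T\<close> takes the
    same value on \<open>v\<close> and on its projection, so their difference lies in the kernel of
    \<open>X\<^sup>T\<close>.\<close>
  have 7: "v - (X * Y) *\<^sub>v v \<in> dual_code n C" if v: "v \<in> carrier_vec n" for v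
  proof -
    have "G * Y = (G * H) * X\<^sup>T" using G H X by (simp add: Y_def)
    also have "G * H = 1\<^sub>m r" by (rule mat_mult_left_right_inverse[OF H(1) G H(2)])
    finally have GY: "G * Y = X\<^sup>T" using X by simp
    let ?w = "(X * Y) *\<^sub>v v"
    have w: "?w \<in> carrier_vec n" using X Y v by simp
    have "X\<^sup>T *\<^sub>v ?w = X\<^sup>T *\<^sub>v (X *\<^sub>v (Y *\<^sub>v v))" using XYv[OF v] by simp
    also have "\<dots> = G *\<^sub>v (Y *\<^sub>v v)"
      unfolding G_def using assoc_mult_mat_vec[OF Xt X, of "Y *\<^sub>v v"] Y v by simp
    also have "\<dots> = X\<^sup>T *\<^sub>v v" using assoc_mult_mat_vec[OF G Y v] GY by simp
    finally have "X\<^sup>T *\<^sub>v (v - ?w) = X\<^sup>T *\<^sub>v v - X\<^sup>T *\<^sub>v v"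
      using mult_minus_distrib_mat_vec[OF Xt v w] by simp
    then show ?thesis using v w X unfolding dual by simp
  qed
  \<comment> \<open>The transpose enters because \<open>row_vec_mult\<close> applies the transposed
    matrix to a vector.\<close>
  have "projects_onto n (X * Y)\<^sup>T C"
    using X Y 4 5 unfolding projects_onto_def row_vec_mult_def by simp
  then show ?thesis using that[OF X Y YX] 6 7 dim by (simp add: code_dim_def)
qed

text \<open>Every \<open>v\<close> is the sum of \<open>(X * Y) *\<^sub>v v\<close> in
  \<open>C\<close> and a remainder in the dual code. A projector is prescribed on both summands,
  hence everywhere.\<close>

lemma ex1_projects_onto:
  assumes LCD: "LCD_code n C"
  shows "\<exists>!M. projects_onto n M C"
proof -
  obtain X r Y where X: "X \<in> carrier_mat n r" and Y: "Y \<in> carrier_mat r n"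
    and "Y * X = 1\<^sub>m r"
    and "projects_onto n (X * Y)\<^sup>T C"
    and E: "\<forall>v\<in>carrier_vec n. (X * Y) *\<^sub>v v \<in> C \<and> v - (X * Y) *\<^sub>v v \<in> dual_code n C"
    and "code_dim n C = r"
    by (rule LCD_code_factorization[OF LCD])
  moreover have "M = (X * Y)\<^sup>T" if M: "projects_onto n M C" for M
  proof -
    have Mc: "M\<^sup>T \<in> carrier_mat n n" using M by (simp add: projects_onto_def)
    have "M\<^sup>T = X * Y"
    proof (rule mat_eq_by_mult_vec[OF Mc])
      show "X * Y \<in> carrier_mat n n" using X Y by simp
      fix v :: "bit vec" assume v: "v \<in> carrier_vec n"
      let ?w = "(X * Y) *\<^sub>v v"
      have w: "?w \<in> carrier_vec n" using X Y v by simp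
      have "v = u + (v - u)" if "u \<in> carrier_vec n" for u
        using v that by (intro eq_vecI) auto
      then have "M\<^sup>T *\<^sub>v v = M\<^sup>T *\<^sub>v (?w + (v - ?w))"
        using w by (intro arg_cong[of _ _ "(*\<^sub>v) M\<^sup>T"])
      also have "\<dots> = M\<^sup>T *\<^sub>v ?w + M\<^sup>T *\<^sub>v (v - ?w)"
        using v w by (intro mult_add_distrib_mat_vec[OF Mc]) auto
      also have "\<dots> = ?w + 0\<^sub>v n"
        using M E v by (simp add: projects_onto_def row_vec_mult_def)
      finally show "M\<^sup>T *\<^sub>v v = ?w" using w by simp
    qed
    then show ?thesis by (metis transpose_transpose)
  qed
  ultimately show ?thesis by blast
qed

text \<open>Uniqueness identifies a given projector with the constructed one, so it inherits the
  factorization whose inner size \<open>r\<close> is the dimension of the code, and its values lie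
  in \<open>C\<close>.\<close>

lemma projects_onto_factorization:
  assumes LCD: "LCD_code n C" and M: "projects_onto n M C"
  obtains X r Y where "X \<in> carrier_mat n r" "Y \<in> carrier_mat r n" "Y * X = 1\<^sub>m r"
    "M = (X * Y)\<^sup>T" "\<forall>v\<in>carrier_vec n. row_vec_mult v M \<in> C" "code_dim n C = r"
proof (rule LCD_code_factorization[OF LCD])
  fix X r Y
  assume X: "X \<in> carrier_mat n r" and Y: "Y \<in> carrier_mat r n" and YX: "Y * X = 1\<^sub>m r"
    and proj: "projects_onto n (X * Y)\<^sup>T C"
    and C: "\<forall>v\<in>carrier_vec n. (X * Y) *\<^sub>v v \<in> C \<and> v - (X * Y) *\<^sub>v v \<in> dual_code n C"
    and dim: "code_dim n C = r"
  have "M = (X * Y)\<^sup>T" using ex1_projects_onto[OF LCD] M proj by blast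
  then show thesis using that[OF X Y YX] C dim by (simp add: row_vec_mult_def)
qed

lemma projects_onto_orthogonal_projector:
  assumes "LCD_code n C"
  shows "projects_onto n (orthogonal_projector n C) C"
  using theI'[OF ex1_projects_onto[OF assms]]
  unfolding orthogonal_projector_def projects_onto_def .

lemma orthogonal_projector_eqI:
  assumes "LCD_code n C" "projects_onto n M C"
  shows "orthogonal_projector n C = M"
  using ex1_projects_onto[OF assms(1)] projects_onto_orthogonal_projector[OF assms(1)] assms(2) by blast

section \<open>Characteristic polynomials of conference matrices\<close>

text \<open>Both sides arise from the determinant of the block matrix with rows \<open>(x I, X)\<close> and
  \<open>(Y, I)\<close>, multiplied on the right by two different block triangular matrices.\<close>

lemma char_poly_mult_commute:
  fixes X Y :: "'a :: idom mat"
  assumes X: "X \<in> carrier_mat n r" and Y: "Y \<in> carrier_mat r n"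
  shows "char_poly (X * Y) * [:0, 1:] ^ r = [:0, 1:] ^ n * char_poly (Y * X)"
proof -
  let ?x = "[:0, 1:] :: 'a poly"
  define X' Y' where "X' = map_mat (\<lambda>a. [:a:]) X" and "Y' = map_mat (\<lambda>a. [:a:]) Y"
  have X': "X' \<in> carrier_mat n r" and Y': "Y' \<in> carrier_mat r n" using X Y by (auto simp: X'_def Y'_def)
  have cp: "char_poly_matrix A = ?x \<cdot>\<^sub>m 1\<^sub>m k - map_mat (\<lambda>a. [:a:]) A" if "A \<in> carrier_mat k k" for A :: "'a mat" and k
    using that by (intro eq_matI) (auto simp: char_poly_matrix_def)
  have XY: "char_poly_matrix (X * Y) = ?x \<cdot>\<^sub>m 1\<^sub>m n - X' * Y'"
    using cp[of "X * Y" n] X Y map_poly_mult(1)[OF X Y] by (simp add: X'_def Y'_def)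
  have YX: "char_poly_matrix (Y * X) = ?x \<cdot>\<^sub>m 1\<^sub>m r - Y' * X'"
    using cp[of "Y * X" r] X Y map_poly_mult(1)[OF Y X] by (simp add: X'_def Y'_def)
  have carrier: "?x \<cdot>\<^sub>m 1\<^sub>m n - X' * Y' \<in> carrier_mat n n" "?x \<cdot>\<^sub>m 1\<^sub>m r - Y' * X' \<in> carrier_mat r r"
    using X' Y' by (auto intro!: minus_carrier_mat)
  let ?M = "four_block_mat (?x \<cdot>\<^sub>m 1\<^sub>m n) X' Y' (1\<^sub>m r)"
  have M: "?M \<in> carrier_mat (n + r) (n + r)" using X' Y' by simp
  \<comment> \<open>\<open>?F1\<close> has determinant 1 and clears the lower left block;
    \<open>?F2\<close> has determinant \<open>?x ^ r\<close> and clears the upper right block. The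
    latter is the source of the factor \<open>[:0, 1:] ^ r\<close>.\<close>
  let ?F1 = "four_block_mat (1\<^sub>m n) (0\<^sub>m n r) (- Y') (1\<^sub>m r)"
  let ?F2 = "four_block_mat (1\<^sub>m n) (- X') (0\<^sub>m r n) (?x \<cdot>\<^sub>m 1\<^sub>m r)"
  have "?M * ?F1 = four_block_mat (?x \<cdot>\<^sub>m 1\<^sub>m n - X' * Y') X' (0\<^sub>m r n) (1\<^sub>m r)"
    using X' Y' by (subst mult_four_block_mat[of _ n n _ r _ r _ _ n _ r])
      (auto simp: minus_add_uminus_mat[of _ n n] uminus_mult_right_mat)
  moreover have "det ?F1 = 1"
    using Y' by (subst det_four_block_mat_upper_right_zero[of _ n _ r]) auto
  ultimately have 1: "det ?M = char_poly (X * Y)"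
    using det_mult[OF M, of ?F1] Y' det_four_block_mat_lower_left_zero[of "?x \<cdot>\<^sub>m 1\<^sub>m n - X' * Y'" n X' r "0\<^sub>m r n" "1\<^sub>m r"] X' carrier
    by (simp add: char_poly_def XY)
  have "?M * ?F2 = four_block_mat (?x \<cdot>\<^sub>m 1\<^sub>m n) (0\<^sub>m n r) Y' (?x \<cdot>\<^sub>m 1\<^sub>m r - Y' * X')"
  proof -
    have "?x \<cdot>\<^sub>m 1\<^sub>m n * (- X') + X' * (?x \<cdot>\<^sub>m 1\<^sub>m r) = 0\<^sub>m n r"
      using X' mult_smult_assoc_mat[of "1\<^sub>m n" n n X' r ?x] mult_smult_distrib[of X' n r "1\<^sub>m r" r ?x]
      by (intro eq_matI) auto
    moreover have "Y' * (- X') + 1\<^sub>m r * (?x \<cdot>\<^sub>m 1\<^sub>m r) = ?x \<cdot>\<^sub>m 1\<^sub>m r - Y' * X'"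
      using X' Y' by (intro eq_matI) auto
    ultimately show ?thesis
      using X' Y' by (subst mult_four_block_mat[of _ n n _ r _ r _ _ n _ r]) auto
  qed
  moreover have "det ?F2 = ?x ^ r"
    using X' by (subst det_four_block_mat_lower_left_zero[of _ n _ r]) auto
  ultimately have "det ?M * ?x ^ r = ?x ^ n * char_poly (Y * X)"
    using det_mult[OF M, of ?F2] X' det_four_block_mat_upper_right_zero[of "?x \<cdot>\<^sub>m 1\<^sub>m n" n "0\<^sub>m n r" r Y' "?x \<cdot>\<^sub>m 1\<^sub>m r - Y' * X'"] Y' carrier
    by (simp add: char_poly_def YX)
  then show ?thesis using 1 by simp
qed

lemma char_poly_one_mat: "char_poly (1\<^sub>m r :: 'a :: comm_ring_1 mat) = [:-1, 1:] ^ r"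
proof -
  have "diag_mat (1\<^sub>m r :: 'a mat) = replicate r 1"
    by (intro nth_equalityI) (auto simp: diag_mat_def)
  then show ?thesis
    by (subst char_poly_upper_triangular[of _ r]) (auto simp: upper_triangular_def)
qed

section \<open>Traces and eigenvalues of complex matrices\<close>

definition mat_trace :: "'a :: comm_monoid_add mat \<Rightarrow> 'a" where
  "mat_trace M = (\<Sum>i<dim_row M. M $$ (i, i))"

lemma mat_mult_index_sum:
  assumes "M \<in> carrier_mat n r" "N \<in> carrier_mat r k" "i < n" "j < k"
  shows "(M * N) $$ (i, j) = (\<Sum>l<r. M $$ (i, l) * N $$ (l, j))"
  using assms by (simp add: scalar_prod_def lessThan_atLeast0)

lemma mult_mat_vec_index_sum:
  assumes "M \<in> carrier_mat n k" "v \<in> carrier_vec k" "i < n"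
  shows "(M *\<^sub>v v) $ i = (\<Sum>j<k. M $$ (i, j) * v $ j)"
  using assms by (simp add: scalar_prod_def lessThan_atLeast0)

lemma mat_trace_mult_commute:
  fixes M N :: "'a :: comm_semiring_0 mat"
  assumes "M \<in> carrier_mat n r" "N \<in> carrier_mat r n"
  shows "mat_trace (M * N) = mat_trace (N * M)"
proof -
  have "mat_trace (M * N) = (\<Sum>i<n. \<Sum>l<r. M $$ (i, l) * N $$ (l, i))"
    using assms unfolding mat_trace_def by (auto intro!: sum.cong simp: mat_mult_index_sum simp del: index_mult_mat(1))
  also have "\<dots> = (\<Sum>l<r. \<Sum>i<n. N $$ (l, i) * M $$ (i, l))"
    by (subst sum.swap) (simp add: mult.commute)
  also have "\<dots> = mat_trace (N * M)"
    using assms unfolding mat_trace_def by (auto intro!: sum.cong simp: mat_mult_index_sum simp del: index_mult_mat(1))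
  finally show ?thesis .
qed

lemma mat_trace_conjugate:
  fixes B :: "'a :: comm_semiring_1 mat"
  assumes "P \<in> carrier_mat n n" "Q \<in> carrier_mat n n" "B \<in> carrier_mat n n" "Q * P = 1\<^sub>m n"
  shows "mat_trace (P * B * Q) = mat_trace B"
proof -
  have "mat_trace (P * B * Q) = mat_trace (Q * (P * B))"
    using assms by (intro mat_trace_mult_commute[of _ n n]) auto
  also have "Q * (P * B) = B"
    using assoc_mult_mat[OF assms(2,1,3)] assms(3,4) by simp
  finally show ?thesis .
qed

lemma upper_triangular_square_diag:
  fixes B :: "'a :: comm_semiring_1 mat"
  assumes B: "B \<in> carrier_mat n n" "upper_triangular B" and i: "i < n"
  shows "(B * B) $$ (i, i) = (B $$ (i, i))\<^sup>2"
proof -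
  have "(B * B) $$ (i, i) = (\<Sum>l<n. B $$ (i, l) * B $$ (l, i))" using B i mat_mult_index_sum by blast
  also have "\<dots> = (\<Sum>l<n. if l = i then (B $$ (i, i))\<^sup>2 else 0)"
  proof (rule sum.cong)
    fix l assume "l \<in> {..<n}"
    then show "B $$ (i, l) * B $$ (l, i) = (if l = i then (B $$ (i, i))\<^sup>2 else 0)"
      using B i by (cases l i rule: linorder_cases) (auto simp: power2_eq_square upper_triangular_def)
  qed simp
  finally show ?thesis using i by simp
qed

text \<open>Schur decomposition makes \<open>A\<close> similar to an upper triangular
  \<open>B\<close>. Its diagonal lists the eigenvalues with algebraic multiplicity, the diagonal of
  \<open>B * B\<close> lists their squares, and traces are invariant under similarity.\<close>

lemma complex_eigenvalues_trace:
  fixes A :: "complex mat"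
  assumes A: "A \<in> carrier_mat n n"
  obtains e where "char_poly A = (\<Prod>i<n. [:- e i, 1:])"
    "\<And>i. i < n \<Longrightarrow> eigenvalue A (e i)"
    "(\<Sum>i<n. e i) = mat_trace A" "(\<Sum>i<n. (e i)\<^sup>2) = mat_trace (A * A)"
proof -
  obtain es where "char_poly A = (\<Prod>a\<leftarrow>es. [:- a, 1:])" using char_poly_factorized[OF A] by blast
  from schur_decomposition_exists[OF A this] obtain B where B: "B \<in> carrier_mat n n" "upper_triangular B"
    and sim: "similar_mat A B" by blast
  from sim obtain P Q where wit: "similar_mat_wit A B P Q" by (auto simp: similar_mat_def)
  note w = similar_mat_witD2[OF A wit]
  define e where "e = (\<lambda>i. B $$ (i, i))"
  have "char_poly A = (\<Prod>a\<leftarrow>diag_mat B. [:- a, 1:])"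
    using char_poly_similar[OF sim] char_poly_upper_triangular[OF B] by simp
  also have "\<dots> = (\<Prod>i<n. [:- e i, 1:])"
    using B by (simp add: diag_mat_def e_def prod.list_conv_set_nth lessThan_atLeast0 o_def)
  finally have 1: "char_poly A = (\<Prod>i<n. [:- e i, 1:])" .
  have 2: "eigenvalue A (e i)" if "i < n" for i
    unfolding eigenvalue_root_char_poly[OF A] 1 poly_prod using that by (auto intro!: prod_zero)
  have 3: "(\<Sum>i<n. e i) = mat_trace A"
    using mat_trace_conjugate[of P n Q B] w B by (simp add: mat_trace_def[of B] e_def)
  have "A * A = P * (B * B) * Q"
  proof -
    have PB: "P * B \<in> carrier_mat n n" and BQ: "B * Q \<in> carrier_mat n n" using w by auto
    have "A * A = (P * B) * (Q * (P * (B * Q)))"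
      using w PB BQ by (simp add: assoc_mult_mat[of _ n n _ n _ n])
    also have "Q * (P * (B * Q)) = B * Q"
      using assoc_mult_mat[OF w(7) w(6) BQ] w(2) left_mult_one_mat[OF BQ] by simp
    also have "(P * B) * (B * Q) = P * (B * B) * Q"
      using w PB BQ by (simp add: assoc_mult_mat[of _ n n _ n _ n])
    finally show ?thesis .
  qed
  then have "mat_trace (A * A) = mat_trace (B * B)"
    using mat_trace_conjugate[of P n Q "B * B"] w B by simp
  then have 4: "(\<Sum>i<n. (e i)\<^sup>2) = mat_trace (A * A)"
    using upper_triangular_square_diag[OF B] B by (simp add: mat_trace_def[of "B * B"] e_def del: index_mult_mat(1))
  show ?thesis by (rule that[OF 1 2 3 4])
qed

section \<open>Conference matrices and their spectrum\<close>

text \<open>The counts \<open>m - 1\<close> and \<open>m\<close> for adjacent and non-adjacent pairs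
  merge into \<open>of_nat m - A $$ (i, j)\<close>. In this form the conditions make sense over
  every commutative ring, in particular over the complex numbers and over F_2.\<close>

definition conference_mat :: "nat \<Rightarrow> 'a :: comm_ring_1 mat \<Rightarrow> bool" where
  "conference_mat m A \<longleftrightarrow> A \<in> carrier_mat (4 * m + 1) (4 * m + 1) \<and>
     (\<forall>i<4 * m + 1. A $$ (i, i) = 0) \<and>
     (\<forall>i<4 * m + 1. \<forall>j<4 * m + 1. A $$ (i, j) = A $$ (j, i)) \<and>
     (\<forall>i<4 * m + 1. (\<Sum>j<4 * m + 1. A $$ (i, j)) = of_nat (2 * m)) \<and>
     (\<forall>i<4 * m + 1. \<forall>j<4 * m + 1.
        (A * A) $$ (i, j) = (if i = j then of_nat (2 * m) else of_nat m - A $$ (i, j)))"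

text \<open>By symmetry the column sums are also \<open>2 * m\<close>, so adding up the coordinates
  of \<open>A *\<^sub>v v = e \<cdot>\<^sub>v v\<close> yields \<open>e = 2 * m\<close> unless the
  coordinates of \<open>v\<close> sum to 0. In that case \<open>J\<close> annihilates
  \<open>v\<close>, and the formula for \<open>A\<^sup>2\<close> leaves the quadratic
  equation.\<close>

lemma conference_mat_eigenvalue:
  fixes A :: "complex mat"
  assumes A: "conference_mat m A" and e: "eigenvalue A e"
  shows "e = of_nat (2 * m) \<or> e\<^sup>2 + e = of_nat m"
proof -
  define n where "n = 4 * m + 1"
  note A' = A[unfolded conference_mat_def, folded n_def]
  then have Ac: "A \<in> carrier_mat n n" by simp
  then have dims: "dim_row A = n" "dim_col A = n" by auto
  obtain v where v: "v \<in> carrier_vec n" "v \<noteq> 0\<^sub>v n" "A *\<^sub>v v = e \<cdot>\<^sub>v v"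
    using e Ac by (auto simp: eigenvalue_def eigenvector_def)
  have row: "(\<Sum>j<n. A $$ (i, j) * v $ j) = e * v $ i" if "i < n" for i
  proof -
    have "(A *\<^sub>v v) $ i = (\<Sum>j<n. A $$ (i, j) * v $ j)"
      by (rule mult_mat_vec_index_sum[OF Ac v(1) that])
    then show ?thesis using v that by simp
  qed
  have "e * (\<Sum>i<n. v $ i) = (\<Sum>i<n. \<Sum>j<n. A $$ (i, j) * v $ j)"
    by (simp only: sum_distrib_left) (rule sum.cong, simp, rule row[symmetric], simp)
  also have "\<dots> = (\<Sum>j<n. (\<Sum>i<n. A $$ (j, i)) * v $ j)"
    using A' unfolding sum_distrib_right by (subst sum.swap) (intro sum.cong refl, auto)
  also have "\<dots> = of_nat (2 * m) * (\<Sum>j<n. v $ j)"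
    using A' unfolding sum_distrib_left by (intro sum.cong refl) auto
  finally have total: "e = of_nat (2 * m) \<or> (\<Sum>i<n. v $ i) = 0" by auto
  obtain i where i: "i < n" "v $ i \<noteq> 0" using v by (metis carrier_vecD eq_vecI index_zero_vec)
  have "((A * A) *\<^sub>v v) $ i = e * (e * v $ i)"
    using Ac v i by (simp add: mult_mat_vec[of _ n n])
  moreover have "((A * A) *\<^sub>v v) $ i = (\<Sum>j<n. (A * A) $$ (i, j) * v $ j)"
    using mult_mat_vec_index_sum[OF mult_carrier_mat[OF Ac Ac] v(1) i(1)] .
  \<comment> \<open>Row \<open>i\<close> of \<open>A * A\<close> is written as that of
    \<open>m I + m J - A\<close>; at \<open>j = i\<close> this uses the zero diagonal of
    \<open>A\<close>.\<close>
  moreover have "\<dots> = (\<Sum>j<n. (if j = i then of_nat m * v $ i else 0) + of_nat m * v $ j - A $$ (i, j) * v $ j)"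
    using A' i by (intro sum.cong) (auto simp: algebra_simps simp del: index_mult_mat(1))
  moreover have "\<dots> = of_nat m * v $ i + of_nat m * (\<Sum>j<n. v $ j) - e * v $ i"
    using row[OF i(1)] i(1) by (simp add: sum.distrib sum_subtractf sum_distrib_left)
  ultimately have "(e\<^sup>2 + e - of_nat m) * v $ i = of_nat m * (\<Sum>j<n. v $ j)"
    by (simp add: algebra_simps power2_eq_square)
  with total i show ?thesis by auto
qed

text \<open>The traces of \<open>A\<close> and \<open>A\<^sup>2\<close> force the eigenvalue \<open>2 m\<close> to be simple and the two roots of
  \<open>x\<^sup>2 + x - m\<close> to occur equally often; this covers square and non-square \<open>4 m + 1\<close> alike.\<close>

lemma conference_mat_char_poly_complex:
  fixes A :: "complex mat"
  assumes A: "conference_mat m A" and m: "m > 0"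
  shows "char_poly A = [:- of_nat (2 * m), 1:] * [:- of_nat m, 1, 1:] ^ (2 * m)"
proof -
  define n where "n = 4 * m + 1"
  note A' = A[unfolded conference_mat_def, folded n_def]
  then have Ac: "A \<in> carrier_mat n n" by simp
  then have dims: "dim_row A = n" "dim_col A = n" by auto
  obtain e where cp: "char_poly A = (\<Prod>i<n. [:- e i, 1:])"
    and ev: "\<And>i. i < n \<Longrightarrow> eigenvalue A (e i)"
    and tr: "(\<Sum>i<n. e i) = mat_trace A" "(\<Sum>i<n. (e i)\<^sup>2) = mat_trace (A * A)"
    using complex_eigenvalues_trace[OF Ac] by blast
  have tr1: "(\<Sum>i<n. e i) = 0" using A' dims by (simp add: tr mat_trace_def)
  have tr2: "(\<Sum>i<n. (e i)\<^sup>2) = of_nat (n * (2 * m))"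
    using A' dims by (simp add: tr mat_trace_def del: index_mult_mat(1))
  \<comment> \<open>The discriminant of \<open>x\<^sup>2 + x - m\<close> is
    \<open>4 * m + 1 = n\<close>, so its roots are \<open>t\<close> and \<open>t'\<close>
    below.\<close>
  define s where "s = complex_of_real (sqrt (real n))"
  have s2: "s\<^sup>2 = of_nat n" unfolding s_def of_real_power[symmetric] by simp
  have s0: "s \<noteq> 0" using s2 by (auto simp: n_def simp del: of_nat_add of_nat_Suc)
  define k :: complex where "k = of_nat (2 * m)"
  define t where "t = (s - 1) / 2"
  define t' where "t' = (- s - 1) / 2"
  have tt: "t \<noteq> t'" using s0 by (auto simp: t_def t'_def)
  have tsq: "t\<^sup>2 + t = of_nat m" "t'\<^sup>2 + t' = of_nat m"
    using s2 by (auto simp: n_def t_def t'_def power2_eq_square field_simps)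
  have k2: "k\<^sup>2 + k = of_nat (4 * m * m + 2 * m)" by (simp add: k_def power2_eq_square algebra_simps)
  \<comment> \<open>For positive \<open>m\<close> this shows that \<open>k\<close> is not a root of
    the quadratic, so \<open>k\<close>, \<open>t\<close> and \<open>t'\<close> are three distinct
    values.\<close>
  have "(of_nat (4 * m * m + 2 * m) :: complex) \<noteq> of_nat m" using m by (subst of_nat_eq_iff) simp
  then have kt: "k \<noteq> t" "k \<noteq> t'" using k2 tsq by auto
  have vals: "e i = k \<or> e i = t \<or> e i = t'" if "i < n" for i
  proof -
    have "(e i - t) * (e i - t') = (e i)\<^sup>2 + e i - of_nat m"
      using s2 by (auto simp: n_def t_def t'_def power2_eq_square field_simps)
    then show ?thesis using conference_mat_eigenvalue[OF A ev[OF that]] by (auto simp: k_def)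
  qed
  define K where "K x = {i. i < n \<and> e i = x}" for x
  have fin: "finite (K x)" for x by (simp add: K_def)
  have split: "{..<n} = K k \<union> K t \<union> K t'" using vals by (auto simp: K_def)
  have disj: "K k \<inter> K t = {}" "(K k \<union> K t) \<inter> K t' = {}" using kt tt by (auto simp: K_def)
  have sum_K: "(\<Sum>i<n. f (e i)) = of_nat (card (K k)) * f k + of_nat (card (K t)) * f t + of_nat (card (K t')) * f t'"
    for f :: "complex \<Rightarrow> complex"
  proof -
    have "(\<Sum>i\<in>K x. f (e i)) = of_nat (card (K x)) * f x" for x by (simp add: K_def)
    then show ?thesis unfolding split using fin disj by (simp add: sum.union_disjoint)
  qed
  have prod_K: "(\<Prod>i<n. f (e i)) = f k ^ card (K k) * f t ^ card (K t) * f t' ^ card (K t')"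
    for f :: "complex \<Rightarrow> complex poly"
  proof -
    have "(\<Prod>i\<in>K x. f (e i)) = f x ^ card (K x)" for x by (simp add: K_def)
    then show ?thesis unfolding split using fin disj by (simp add: prod.union_disjoint)
  qed
  have card: "card (K k) + card (K t) + card (K t') = n"
    using split fin disj by (metis card_Un_disjoint card_lessThan finite_UnI)
  \<comment> \<open>The function \<open>x\<^sup>2 + x\<close> has the same value \<open>m\<close> at
    \<open>t\<close> and \<open>t'\<close>, so this sum isolates the multiplicity of
    \<open>k\<close>.\<close>
  have "of_nat (n * (2 * m)) = (\<Sum>i<n. (e i)\<^sup>2 + e i)"
    using tr1 tr2 by (simp only: sum.distrib add_0_right)
  also have "\<dots> = of_nat (card (K k) * (4 * m * m + 2 * m) + (card (K t) + card (K t')) * m)"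
    unfolding sum_K[of "\<lambda>x. x\<^sup>2 + x"] tsq k2 by (simp add: algebra_simps)
  finally have "n * (2 * m) = card (K k) * (4 * m * m + 2 * m) + (card (K t) + card (K t')) * m"
    by (simp only: of_nat_eq_iff)
  also have "card (K t) + card (K t') = n - card (K k)" using card by simp
  \<comment> \<open>Since \<open>4 * m * m + 2 * m = n * m + m\<close>, the equation becomes
    \<open>2 * n * m = card (K k) * n * m + n * m\<close>, which forces multiplicity 1.\<close>
  also have "card (K k) * (4 * m * m + 2 * m) + (n - card (K k)) * m = card (K k) * (n * m) + n * m"
  proof -
    have "card (K k) \<le> n" using card by simp
    then obtain d where d: "n = card (K k) + d" using le_Suc_ex by blast
    have "card (K k) * (4 * m * m + 2 * m) = card (K k) * (n * m) + card (K k) * m" by (simp add: n_def algebra_simps)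
    moreover have "(n - card (K k)) * m + card (K k) * m = n * m" using d by (simp add: algebra_simps)
    ultimately show ?thesis by simp
  qed
  finally have "m = 0 \<or> n = 0 \<or> Suc 0 = card (K k)" by simp
  then have ck: "card (K k) = 1" using m n_def by linarith
  \<comment> \<open>The map \<open>2 * x + 1\<close> sends \<open>t\<close>, \<open>t'\<close> and
    \<open>k\<close> to \<open>s\<close>, \<open>- s\<close> and \<open>n\<close>. The single
    \<open>k\<close> already accounts for the total \<open>n\<close>, so the contributions of
    \<open>t\<close> and \<open>t'\<close> cancel.\<close>
  have "(\<Sum>i<n. 2 * e i + 1) = of_nat n"
    using tr1 by (simp only: sum.distrib sum_distrib_left[symmetric] sum_constant card_lessThan) simp
  then have "of_nat (card (K t)) * s = of_nat (card (K t')) * s"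
    unfolding sum_K[of "\<lambda>x. 2 * x + 1"] ck by (simp add: n_def k_def t_def t'_def field_simps)
  then have "card (K t) = card (K t')" using s0 by simp
  then have ct: "card (K t) = 2 * m" "card (K t') = 2 * m" using card ck n_def by linarith+
  have factor: "[:- of_nat m, 1, 1:] = [:- t, 1:] * [:- t', 1:]"
    using s2 by (simp add: n_def t_def t'_def power2_eq_square field_simps)
  show ?thesis
    unfolding cp prod_K[of "\<lambda>x. [:- x, 1:]"] ck ct factor power_mult_distrib
    by (simp only: k_def power_one_right mult.assoc)
qed

section \<open>Codes of conference graphs\<close>

lemma vertex_ordering_length:
  assumes "conference_graph q G" "vertex_ordering G vs"
  shows "length vs = q"
  using assms distinct_card unfolding conference_graph_def strongly_regular_graph_def vertex_ordering_def
  by metis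

lemma sum_list_indicator:
  assumes "distinct vs"
  shows "(\<Sum>k<length vs. if P (vs ! k) then 1 else 0) = (of_nat (card {x \<in> set vs. P x}) :: 'r :: semiring_1)"
proof -
  have "bij_betw ((!) vs) {..<length vs} (set vs)" by (rule bij_betw_nth[OF assms refl refl])
  from sum.reindex_bij_betw[OF this, of "\<lambda>x. if P x then 1 else 0 :: 'r"]
  show ?thesis by (simp add: sum.If_cases Int_def)
qed

text \<open>Row sums are degrees, and entries of the square count walks of length two, that is,
  common neighbours.\<close>

lemma conference_mat_adjacency:
  assumes G: "conference_graph (4 * m + 1) G" and vs: "vertex_ordering G vs"
  shows "conference_mat m (adjacency_mat G vs :: 'r :: comm_ring_1 mat)"
proof -
  define n where "n = 4 * m + 1"
  let ?A = "adjacency_mat G vs :: 'r mat"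
  have pg: "pair_graph G" and card: "card (pverts G) = n"
    and deg: "\<And>x. x \<in> pverts G \<Longrightarrow> card (neighbours G x) = 2 * m"
    and adj: "\<And>x y. x \<in> pverts G \<Longrightarrow> y \<in> pverts G \<Longrightarrow> (x, y) \<in> parcs G \<Longrightarrow>
      card (neighbours G x \<inter> neighbours G y) = m - 1"
    and nonadj: "\<And>x y. x \<in> pverts G \<Longrightarrow> y \<in> pverts G \<Longrightarrow> x \<noteq> y \<Longrightarrow> (x, y) \<notin> parcs G \<Longrightarrow>
      card (neighbours G x \<inter> neighbours G y) = m"
  proof -
    \<comment> \<open>At \<open>m = 0\<close> both subtractions truncate to 0, so the equation holds
      there as well.\<close>
    have "(4 * m + 1 - 5) div 4 = m - 1" by (cases m) auto
    then show "pair_graph G" "card (pverts G) = n"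
      "\<And>x. x \<in> pverts G \<Longrightarrow> card (neighbours G x) = 2 * m"
      "\<And>x y. x \<in> pverts G \<Longrightarrow> y \<in> pverts G \<Longrightarrow> (x, y) \<in> parcs G \<Longrightarrow>
        card (neighbours G x \<inter> neighbours G y) = m - 1"
      "\<And>x y. x \<in> pverts G \<Longrightarrow> y \<in> pverts G \<Longrightarrow> x \<noteq> y \<Longrightarrow> (x, y) \<notin> parcs G \<Longrightarrow>
        card (neighbours G x \<inter> neighbours G y) = m"
      using G unfolding conference_graph_def strongly_regular_graph_def n_def by auto
  qed
  \<comment> \<open>The number 1 is not a prime power. Positivity makes
    \<open>of_nat (m - 1)\<close> a genuine difference for adjacent pairs.\<close>
  have m: "m > 0" using G by (auto simp: conference_graph_def intro: Nat.gr0I)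
  interpret pair_graph G by (rule pg)
  have sym: "(x, y) \<in> parcs G \<longleftrightarrow> (y, x) \<in> parcs G" for x y
    using pair_sym_arcs by (auto simp: symmetric_def sym_def)
  have irr: "(x, x) \<notin> parcs G" for x using pair_no_loops[of "(x, x)"] by auto
  have dv: "distinct vs" and sv: "set vs = pverts G" using vs by (auto simp: vertex_ordering_def)
  have len: "length vs = n" using dv sv card distinct_card by fastforce
  have mem: "vs ! i \<in> pverts G" if "i < n" for i using that len sv nth_mem by blast
  have A: "?A \<in> carrier_mat n n" by (simp add: adjacency_mat_def len)
  have entry: "?A $$ (i, j) = (if (vs ! i, vs ! j) \<in> parcs G then 1 else 0)" if "i < n" "j < n" for i j
    using that by (simp add: adjacency_mat_def len)
  have row: "(\<Sum>j<n. ?A $$ (i, j)) = of_nat (2 * m)" if i: "i < n" for i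
  proof -
    have "(\<Sum>j<n. ?A $$ (i, j)) = (\<Sum>j<length vs. if (vs ! i, vs ! j) \<in> parcs G then 1 else 0)"
      using i by (simp add: entry len)
    also have "\<dots> = of_nat (card (neighbours G (vs ! i)))"
      unfolding sum_list_indicator[OF dv, of "\<lambda>y. (vs ! i, y) \<in> parcs G"] sv neighbours_def ..
    finally show ?thesis using deg mem i by simp
  qed
  have square: "(?A * ?A) $$ (i, j) = (if i = j then of_nat (2 * m) else of_nat m - ?A $$ (i, j))"
    if i: "i < n" and j: "j < n" for i j
  proof -
    have "(?A * ?A) $$ (i, j) = (\<Sum>l<n. ?A $$ (i, l) * ?A $$ (l, j))"
      by (rule mat_mult_index_sum[OF A A i j])
    also have "\<dots> = (\<Sum>l<length vs. if (vs ! i, vs ! l) \<in> parcs G \<and> (vs ! l, vs ! j) \<in> parcs G then 1 else 0)"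
      using i j by (auto simp: entry len intro!: sum.cong)
    also have "\<dots> = of_nat (card (neighbours G (vs ! i) \<inter> neighbours G (vs ! j)))"
      unfolding sum_list_indicator[OF dv, of "\<lambda>y. (vs ! i, y) \<in> parcs G \<and> (y, vs ! j) \<in> parcs G"] sv
      by (rule arg_cong[of _ _ "\<lambda>S. of_nat (card S)"]) (auto simp: neighbours_def sym)
    finally have *: "(?A * ?A) $$ (i, j) = of_nat (card (neighbours G (vs ! i) \<inter> neighbours G (vs ! j)))" .
    show ?thesis
    proof (cases "i = j")
      case True
      then show ?thesis using * deg mem i by simp
    next
      case False
      then have "vs ! i \<noteq> vs ! j" using dv len i j nth_eq_iff_index_eq by blast
      then show ?thesis using * False adj[OF mem mem] nonadj[OF mem mem] i j m
        by (auto simp: entry of_nat_diff simp del: index_mult_mat(1))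
    qed
  qed
  show ?thesis
    unfolding conference_mat_def n_def[symmetric] using A row square
    by (auto simp: entry irr sym simp del: index_mult_mat(1))
qed

section \<open>Reduction modulo 2 and the dimension of the code\<close>

lemma adjacency_mat_of_int:
  "map_mat of_int (adjacency_mat G vs) = (adjacency_mat G vs :: 'r :: ring_1 mat)"
  by (intro eq_matI) (auto simp: adjacency_mat_def)

text \<open>The integers link characteristic 0 with characteristic 2: the adjacency matrix is
  integral, and the complex identity descends because \<open>of_int\<close> is injective on
  polynomials.\<close>

lemma char_poly_conference_int:
  assumes G: "conference_graph (4 * m + 1) G" and vs: "vertex_ordering G vs"
  shows "char_poly (adjacency_mat G vs :: int mat) = [:- of_nat (2 * m), 1:] * [:- of_nat m, 1, 1:] ^ (2 * m)"
    (is "char_poly ?A = ?p")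
proof -
  have A: "?A \<in> carrier_mat (length vs) (length vs)" by (simp add: adjacency_mat_def)
  have m: "m > 0" using G by (auto simp: conference_graph_def intro: Nat.gr0I)
  have "map_poly complex_of_int (char_poly ?A) = char_poly (adjacency_mat G vs)"
    using of_int_hom.char_poly_hom[OF A, where 'a = complex] by (simp add: adjacency_mat_of_int)
  also have "\<dots> = [:- of_nat (2 * m), 1:] * [:- of_nat m, 1, 1:] ^ (2 * m)"
    by (rule conference_mat_char_poly_complex[OF conference_mat_adjacency[OF G vs] m])
  also have "\<dots> = map_poly complex_of_int ?p"
    by (simp add: hom_distribs)
  finally show ?thesis by simp
qed

text \<open>For even \<open>m\<close> both \<open>2 * m\<close> and \<open>m\<close> vanish in F_2,
  so the linear factor becomes \<open>x\<close> and the quadratic one splits as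
  \<open>x (x - 1)\<close>.\<close>

lemma char_poly_conference_bit:
  assumes G: "conference_graph (4 * m + 1) G" and vs: "vertex_ordering G vs" and m: "even m"
  shows "char_poly (adjacency_mat G vs :: bit mat) = [:0, 1:] ^ (2 * m + 1) * [:- 1, 1:] ^ (2 * m)"
proof -
  let ?A = "adjacency_mat G vs :: int mat"
  have A: "?A \<in> carrier_mat (length vs) (length vs)" by (simp add: adjacency_mat_def)
  have m0: "(of_nat m :: bit) = 0" using m by (simp only: of_nat_bit_eq_0_iff)
  have "char_poly (adjacency_mat G vs :: bit mat) = map_poly of_int (char_poly ?A)"
    using of_int_hom.char_poly_hom[OF A, where 'a = bit] by (simp add: adjacency_mat_of_int)
  also have "\<dots> = [:0, 1:] * [:0, 1, 1:] ^ (2 * m)"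
    unfolding char_poly_conference_int[OF G vs] using m0 by (simp add: hom_distribs)
  also have "[:0, 1, 1:] = [:0, 1:] * ([:- 1, 1:] :: bit poly)" by simp
  finally show ?thesis by (simp only: power_mult_distrib power_add power_one_right ac_simps)
qed

lemma order_linear_powers:
  fixes a b :: "'a :: idom"
  assumes "a \<noteq> b"
  shows "order b ([:- a, 1:] ^ k * [:- b, 1:] ^ l) = l"
proof -
  have "order b ([:- a, 1:] ^ k) = 0" using assms by (intro order_0I) (simp add: poly_power)
  then show ?thesis by (subst order_mult) (auto simp: order_power_n_n)
qed

text \<open>From \<open>Y * X = 1\<^sub>m r\<close>, the polynomial of \<open>X * Y\<close> times
  \<open>x ^ r\<close> equals \<open>x ^ n (x - 1) ^ r\<close>. Comparing the order of the root 1
  with the explicit polynomial gives \<open>r = 2 * m\<close>.\<close>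

lemma code_dim_yields_code:
  assumes G: "conference_graph (4 * m + 1) G" and vs: "vertex_ordering G vs" and m: "even m"
    and C: "yields_code G vs C"
  shows "code_dim (length vs) C = 2 * m"
proof -
  let ?n = "length vs" and ?A = "adjacency_mat G vs :: bit mat"
  have LCD: "LCD_code ?n C" and A: "?A = orthogonal_projector ?n C"
    using C by (auto simp: yields_code_def)
  obtain X r Y where X: "X \<in> carrier_mat ?n r" and Y: "Y \<in> carrier_mat r ?n" and YX: "Y * X = 1\<^sub>m r"
    and "?A = (X * Y)\<^sup>T"
    and "\<forall>v\<in>carrier_vec ?n. row_vec_mult v ?A \<in> C" and dim: "code_dim ?n C = r"
    unfolding A by (rule projects_onto_factorization[OF LCD projects_onto_orthogonal_projector[OF LCD]])
  then have "char_poly ?A = char_poly (X * Y)" using char_poly_transpose_mat X Y by (metis mult_carrier_mat)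
  moreover have n: "?n = 4 * m + 1" by (rule vertex_ordering_length[OF G vs])
  ultimately have "[:0, 1:] ^ (2 * m + 1) * [:- 1, 1:] ^ (2 * m) * [:0, 1:] ^ r
      = [:0, 1:] ^ (4 * m + 1) * ([:- 1, 1:] :: bit poly) ^ r"
    using char_poly_mult_commute[OF X Y] YX char_poly_one_mat char_poly_conference_bit[OF G vs m]
    by metis
  \<comment> \<open>The root 0 is written as \<open>- 0\<close> to match the shape of
    \<open>order_linear_powers\<close>.\<close>
  then have "[:- 0, 1:] ^ (2 * m + 1 + r) * [:- 1, 1:] ^ (2 * m)
      = [:- 0, 1:] ^ (4 * m + 1) * ([:- 1, 1:] :: bit poly) ^ r"
    by (simp only: power_add minus_zero ac_simps)
  from arg_cong[OF this, of "order 1"] have "2 * m = r"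
    by (simp only: order_linear_powers[OF zero_neq_one])
  then show ?thesis using dim by simp
qed

text \<open>The all-ones vector is orthogonal to every fixed vector of \<open>A\<close>, because \<open>A\<close> has even row
  sums; hence the code of fixed vectors is even.\<close>

lemma yields_even_LCD_code_if_even:
  fixes m :: nat
  assumes G: "conference_graph (4 * m + 1) G" and vs: "vertex_ordering G vs" and m: "even m"
  shows "yields_even_LCD_code G vs"
proof -
  define n where "n = 4 * m + 1"
  have len: "length vs = n" using vertex_ordering_length[OF G vs] by (simp add: n_def)
  define A :: "bit mat" where "A = adjacency_mat G vs"
  have A: "A \<in> carrier_mat n n"
    and sym: "\<And>i j. i < n \<Longrightarrow> j < n \<Longrightarrow> A $$ (i, j) = A $$ (j, i)"
    and row: "\<And>i. i < n \<Longrightarrow> (\<Sum>j<n. A $$ (i, j)) = of_nat (2 * m)"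
    and sq: "\<And>i j. i < n \<Longrightarrow> j < n \<Longrightarrow> (A * A) $$ (i, j) = (if i = j then of_nat (2 * m) else of_nat m - A $$ (i, j))"
    and diag: "\<And>i. i < n \<Longrightarrow> A $$ (i, i) = 0"
    using conference_mat_adjacency[OF G vs, where 'r = bit] unfolding conference_mat_def A_def n_def by auto
  have m0: "(of_nat m :: bit) = 0" using m by (simp only: of_nat_bit_eq_0_iff)
  have At: "A\<^sup>T = A" using A sym by (intro eq_matI) auto
  \<comment> \<open>Over F_2 with \<open>m\<close> even, \<open>of_nat m - A $$ (i, j)\<close> is
    \<open>A $$ (i, j)\<close>, and the diagonal entry \<open>2 * m\<close> is 0 like that of
    \<open>A\<close>.\<close>
  have AA: "A * A = A"
  proof (rule eq_matI)
    fix i j assume "i < dim_row A" "j < dim_col A"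
    then have "i < n" "j < n" using A by auto
    then show "(A * A) $$ (i, j) = A $$ (i, j)"
      using m0 sq[of i j] diag[of i] by (cases "i = j") (auto simp del: index_mult_mat(1))
  qed (use A in auto)
  have AAv: "A *\<^sub>v (A *\<^sub>v v) = A *\<^sub>v v" if "v \<in> carrier_vec n" for v
    using assoc_mult_mat_vec[OF A A that] AA by simp
  define C where "C = {v \<in> carrier_vec n. A *\<^sub>v v = v}"
  interpret V: vec_space "TYPE(bit)" n .
  have zero: "A *\<^sub>v 0\<^sub>v n = 0\<^sub>v n" using A by (intro eq_vecI) auto
  have "subspace class_ring C V.V"
    unfolding subspace_def
  proof
    show "vectorspace class_ring V.V" by (rule V.vectorspace_axioms)
    show "submodule class_ring C V.V"
    proof (rule submodule.intro)
      show "module class_ring V.V" by (rule V.module_axioms)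
    qed (use A zero in \<open>auto simp: C_def mult_add_distrib_mat_vec[OF A] mult_mat_vec[OF A]\<close>)
  qed
  then have code: "binary_code n C" by (simp add: binary_code_def)
  have swap: "(A *\<^sub>v v) \<bullet> w = v \<bullet> (A *\<^sub>v w)" if "v \<in> carrier_vec n" "w \<in> carrier_vec n" for v w
    using transpose_vec_mult_scalar[OF A that(2,1)] At by simp
  \<comment> \<open>By idempotence the vectors \<open>A *\<^sub>v unit_vec n i\<close> lie in
    \<open>C\<close>. Orthogonality of \<open>v\<close> to them, moved across by symmetry, makes
    every coordinate of \<open>A *\<^sub>v v\<close> zero.\<close>
  have dual: "A *\<^sub>v v = 0\<^sub>v n" if "v \<in> dual_code n C" for v
  proof (rule eq_vecI)
    have v: "v \<in> carrier_vec n" using that by (simp add: dual_code_iff)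
    fix i assume i: "i < dim_vec (0\<^sub>v n :: bit vec)"
    have "A *\<^sub>v unit_vec n i \<in> C" using A AAv by (auto simp: C_def)
    then have "(A *\<^sub>v v) \<bullet> unit_vec n i = 0"
      using that swap[OF v] by (simp add: dual_code_iff)
    then show "(A *\<^sub>v v) $ i = 0\<^sub>v n $ i"
      using i A v scalar_prod_right_unit[of i n "A *\<^sub>v v"] by (auto simp del: scalar_prod_right_unit)
  qed (use A in auto)
  have "0\<^sub>v n \<in> dual_code n C" by (auto simp: dual_code_iff C_def)
  then have "C \<inter> dual_code n C = {0\<^sub>v n}" using dual zero by (auto simp: C_def)
  then have LCD: "LCD_code n C" using code by (simp add: LCD_code_def)
  have "even (hamming_weight v)" if "v \<in> C" for v
  proof -
    have v: "v \<in> carrier_vec n" "A *\<^sub>v v = v" using that by (auto simp: C_def)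
    \<comment> \<open>As squares are trivial in F_2, \<open>v \<bullet> v\<close> is the inner
      product of \<open>v\<close> with the all-ones vector.\<close>
    have "v \<bullet> v = (\<Sum>i<n. v $ i)"
      unfolding scalar_prod_def using v by (auto simp: lessThan_atLeast0 intro!: sum.cong)
    also have "\<dots> = (\<Sum>i<n. \<Sum>j<n. A $$ (i, j) * v $ j)"
    proof (rule sum.cong)
      fix i assume "i \<in> {..<n}"
      then have "(A *\<^sub>v v) $ i = (\<Sum>j<n. A $$ (i, j) * v $ j)"
        using mult_mat_vec_index_sum[OF A v(1)] by simp
      then show "v $ i = (\<Sum>j<n. A $$ (i, j) * v $ j)" using v(2) by simp
    qed simp
    also have "\<dots> = (\<Sum>j<n. (\<Sum>i<n. A $$ (j, i)) * v $ j)"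
      unfolding sum_distrib_right by (subst sum.swap) (auto intro!: sum.cong simp: sym)
    also have "\<dots> = 0" using row by simp
    finally show ?thesis using scalar_prod_self_bit[of v] of_nat_bit_eq_0_iff by metis
  qed
  then have even: "even_code C" by (simp add: even_code_def)
  have "projects_onto n A C"
    using A At dual by (simp add: projects_onto_def row_vec_mult_def C_def)
  then have "orthogonal_projector n C = A" by (rule orthogonal_projector_eqI[OF LCD])
  then have "yields_code G vs C" using LCD even len by (simp add: yields_code_def A_def)
  then show ?thesis by (auto simp: yields_even_LCD_code_def)
qed

text \<open>A projector is idempotent because its values lie in the code it fixes. Off the diagonal,
  \<open>A * A = A\<close> reads \<open>m - a = a\<close>, hence \<open>m = 2 a = 0\<close> in
  F_2.\<close>

lemma even_if_yields_code:
  fixes m :: nat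
  assumes G: "conference_graph (4 * m + 1) G" and vs: "vertex_ordering G vs" and C: "yields_code G vs C"
  shows "even m"
proof -
  define n where "n = 4 * m + 1"
  have len: "length vs = n" using vertex_ordering_length[OF G vs] by (simp add: n_def)
  define A :: "bit mat" where "A = adjacency_mat G vs"
  have A: "A \<in> carrier_mat n n"
    and sym: "\<And>i j. i < n \<Longrightarrow> j < n \<Longrightarrow> A $$ (i, j) = A $$ (j, i)"
    and sq: "\<And>i j. i < n \<Longrightarrow> j < n \<Longrightarrow> (A * A) $$ (i, j) = (if i = j then of_nat (2 * m) else of_nat m - A $$ (i, j))"
    using conference_mat_adjacency[OF G vs, where 'r = bit] unfolding conference_mat_def A_def n_def by auto
  have At: "A\<^sup>T = A" using A sym by (intro eq_matI) auto
  have LCD: "LCD_code n C" and "A = orthogonal_projector n C"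
    using C by (auto simp: yields_code_def len A_def)
  then have proj: "projects_onto n A C" using projects_onto_orthogonal_projector by simp
  obtain X r Y where X: "X \<in> carrier_mat n r" and Y: "Y \<in> carrier_mat r n" and "Y * X = 1\<^sub>m r"
    and "A = (X * Y)\<^sup>T"
    and AC: "\<forall>v\<in>carrier_vec n. row_vec_mult v A \<in> C" and "code_dim n C = r"
    by (rule projects_onto_factorization[OF LCD proj])
  have "A * A = A"
  proof (rule mat_eq_by_mult_vec)
    fix v :: "bit vec" assume v: "v \<in> carrier_vec n"
    show "A * A *\<^sub>v v = A *\<^sub>v v"
      using assoc_mult_mat_vec[OF A A v] proj AC v At by (simp add: projects_onto_def row_vec_mult_def)
  qed (use A in auto)
  \<comment> \<open>This makes 0 and 1 two valid distinct indices, so an off-diagonal entry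
    exists.\<close>
  moreover have "m > 0" using G by (auto simp: conference_graph_def intro: Nat.gr0I)
  ultimately have "A $$ (0, 1) = of_nat m - A $$ (0, 1)" using sq[of 0 1] by (simp add: n_def)
  then have "of_nat m = A $$ (0, 1) + A $$ (0, 1)" by (metis diff_add_cancel)
  also have "\<dots> = 0" unfolding mult_2[symmetric] bit_2_eq_0 mult_zero_left ..
  finally show ?thesis by (simp only: of_nat_bit_eq_0_iff)
qed

section \<open>Permutation equivalence and isomorphism\<close>

text \<open>The inverse in the index moves coordinate \<open>i\<close> to position
  \<open>p i\<close>. This is the effect of a row vector multiplied by the permutation matrix with
  ones at \<open>(i, p i)\<close>.\<close>

definition permute_vec :: "(nat \<Rightarrow> nat) \<Rightarrow> 'a vec \<Rightarrow> 'a vec" where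
  "permute_vec p v = vec (dim_vec v) (\<lambda>j. v $ inv_into UNIV p j)"

lemma permute_vec_carrier [simp]: "permute_vec p v \<in> carrier_vec n \<longleftrightarrow> v \<in> carrier_vec n"
  unfolding permute_vec_def carrier_vec_def mem_Collect_eq dim_vec ..

lemma permute_vec_index:
  assumes p: "p permutes {..<n}" and "v \<in> carrier_vec n" "i < n"
  shows "permute_vec p v $ p i = v $ i"
  using assms permutes_in_image[OF p, of i] permutes_inverses(2)[OF p] by (simp add: permute_vec_def)

lemma eq_permute_vecI:
  assumes p: "p permutes {..<n}" and w: "w \<in> carrier_vec n" and v: "v \<in> carrier_vec n"
    and eq: "\<And>i. i < n \<Longrightarrow> w $ p i = v $ i"
  shows "w = permute_vec p v"
proof (rule eq_vecI)
  fix j assume "j < dim_vec (permute_vec p v)"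
  then have "j < n" using v by (simp add: permute_vec_def)
  then obtain i where "i < n" "j = p i" using permutes_image[OF p] by (metis imageE lessThan_iff)
  then show "w $ j = permute_vec p v $ j" using eq permute_vec_index[OF p v] by simp
qed (use v w in \<open>simp add: permute_vec_def\<close>)

lemma row_vec_mult_index_sum:
  assumes "M \<in> carrier_mat n n" "v \<in> carrier_vec n" "j < n"
  shows "row_vec_mult v M $ j = (\<Sum>i<n. M $$ (i, j) * v $ i)"
  using assms by (simp add: row_vec_mult_def scalar_prod_def lessThan_atLeast0)

lemma row_vec_mult_carrier:
  assumes "M \<in> carrier_mat n n" "v \<in> carrier_vec n"
  shows "row_vec_mult v M \<in> carrier_vec n"
  using assms by (simp add: row_vec_mult_def)

lemma row_vec_mult_permutation_mat:
  assumes p: "p permutes {..<n}" and v: "v \<in> carrier_vec n"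
  shows "row_vec_mult v (mat n n (\<lambda>(i, j). if j = p i then 1 else 0)) = permute_vec p v" (is "row_vec_mult v ?P = _")
proof (rule eq_permute_vecI[OF p _ v])
  show "row_vec_mult v ?P \<in> carrier_vec n" using v by (intro row_vec_mult_carrier) auto
  fix i assume i: "i < n"
  have pi: "p i < n" using permutes_in_image[OF p, of i] i by simp
  have "row_vec_mult v ?P $ p i = (\<Sum>l<n. (if p i = p l then 1 else 0) * v $ l)"
    using v pi by (subst row_vec_mult_index_sum[of _ n]) auto
  also have "\<dots> = (\<Sum>l<n. if l = i then v $ i else 0)"
    using permutes_inj[OF p] by (intro sum.cong) (auto simp: inj_eq)
  finally show "row_vec_mult v ?P $ p i = v $ i" using i by simp
qed

lemma permutation_equivalent_iff:
  assumes "C \<subseteq> carrier_vec n"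
  shows "permutation_equivalent n C D \<longleftrightarrow> (\<exists>p. p permutes {..<n} \<and> D = permute_vec p ` C)"
proof -
  have eq: "{row_vec_mult c (mat n n (\<lambda>(i, j). if j = p i then 1 else 0)) | c. c \<in> C} = permute_vec p ` C"
    if "p permutes {..<n}" for p
    unfolding Setcompr_eq_image
    using row_vec_mult_permutation_mat[OF that] assms by (intro image_cong) auto
  show ?thesis
  proof
    assume "permutation_equivalent n C D"
    then obtain p where p: "p permutes {..<n}"
      "D = {row_vec_mult c (mat n n (\<lambda>(i, j). if j = p i then 1 else 0)) | c. c \<in> C}"
      unfolding permutation_equivalent_def permutation_matrix_def by blast
    show "\<exists>p. p permutes {..<n} \<and> D = permute_vec p ` C" using p(1) p(2)[unfolded eq[OF p(1)]] by blast
  next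
    assume "\<exists>p. p permutes {..<n} \<and> D = permute_vec p ` C"
    then obtain p where p: "p permutes {..<n}" "D = permute_vec p ` C" by blast
    show "permutation_equivalent n C D"
      unfolding permutation_equivalent_def permutation_matrix_def p(2) eq[OF p(1), symmetric]
      using p(1) by blast
  qed
qed

text \<open>The entrywise hypothesis says \<open>P M = N P\<close> for the permutation matrix
  \<open>P\<close> of \<open>p\<close>; the claim is this identity applied to a row vector, proved
  by reindexing the sum along \<open>p\<close>.\<close>

lemma row_vec_mult_permute_vec:
  assumes p: "p permutes {..<n}" and M: "M \<in> carrier_mat n n" and N: "N \<in> carrier_mat n n"
    and MN: "\<And>i j. i < n \<Longrightarrow> j < n \<Longrightarrow> M $$ (p i, p j) = N $$ (i, j)"
    and v: "v \<in> carrier_vec n"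
  shows "row_vec_mult (permute_vec p v) M = permute_vec p (row_vec_mult v N)"
proof (rule eq_permute_vecI[OF p])
  show "row_vec_mult (permute_vec p v) M \<in> carrier_vec n" using M v by (simp add: row_vec_mult_carrier)
  show "row_vec_mult v N \<in> carrier_vec n" using N v by (simp add: row_vec_mult_carrier)
  fix j assume j: "j < n"
  have pj: "p j < n" using permutes_in_image[OF p, of j] j by simp
  have "row_vec_mult (permute_vec p v) M $ p j = (\<Sum>i<n. M $$ (i, p j) * permute_vec p v $ i)"
    using M v pj by (simp add: row_vec_mult_index_sum)
  also have "\<dots> = (\<Sum>i<n. M $$ (p i, p j) * permute_vec p v $ p i)"
    by (rule sum.reindex_bij_betw[symmetric]) (rule permutes_imp_bij[OF p])
  also have "\<dots> = (\<Sum>i<n. N $$ (i, j) * v $ i)"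
    using j by (intro sum.cong) (auto simp: MN permute_vec_index[OF p v])
  also have "\<dots> = row_vec_mult v N $ j" using N v j by (simp add: row_vec_mult_index_sum)
  finally show "row_vec_mult (permute_vec p v) M $ p j = row_vec_mult v N $ j" .
qed

lemma scalar_prod_permute_vec:
  assumes p: "p permutes {..<n}" and v: "v \<in> carrier_vec n" and w: "w \<in> carrier_vec n"
  shows "permute_vec p v \<bullet> permute_vec p w = v \<bullet> w"
proof -
  have "permute_vec p v \<bullet> permute_vec p w = (\<Sum>i<n. permute_vec p v $ i * permute_vec p w $ i)"
    unfolding scalar_prod_def lessThan_atLeast0 using w by (intro sum.cong) (simp_all add: permute_vec_def)
  also have "\<dots> = (\<Sum>i<n. permute_vec p v $ p i * permute_vec p w $ p i)"
    by (rule sum.reindex_bij_betw[symmetric]) (rule permutes_imp_bij[OF p])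
  also have "\<dots> = v \<bullet> w"
    unfolding scalar_prod_def lessThan_atLeast0
    using w permute_vec_index[OF p v] permute_vec_index[OF p w] by (intro sum.cong) simp_all
  finally show ?thesis .
qed

lemma permute_vec_eq_iff:
  assumes p: "p permutes {..<n}" and v: "v \<in> carrier_vec n" and w: "w \<in> carrier_vec n"
  shows "permute_vec p v = permute_vec p w \<longleftrightarrow> v = w"
proof
  assume eq: "permute_vec p v = permute_vec p w"
  show "v = w"
  proof (rule eq_vecI)
    fix i assume "i < dim_vec w"
    then show "v $ i = w $ i" using permute_vec_index[OF p v, of i] permute_vec_index[OF p w, of i] w eq by simp
  qed (use v w in simp)
qed simp

lemma permute_vec_surj:
  assumes p: "p permutes {..<n}" and w: "w \<in> carrier_vec n"
  obtains v where "v \<in> carrier_vec n" "w = permute_vec p v"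
proof
  show "vec n (\<lambda>i. w $ p i) \<in> carrier_vec n" by simp
  show "w = permute_vec p (vec n (\<lambda>i. w $ p i))" by (rule eq_permute_vecI[OF p w]) auto
qed

text \<open>This recovers the code from its projector: all values of the projector lie in
  \<open>C\<close>, and a fixed vector is its own value.\<close>

lemma projects_onto_fixed_vectors:
  assumes LCD: "LCD_code n C" and M: "projects_onto n M C"
  shows "C = {v \<in> carrier_vec n. row_vec_mult v M = v}"
proof
  show "C \<subseteq> {v \<in> carrier_vec n. row_vec_mult v M = v}"
    using LCD_code_carrier[OF LCD] M by (auto simp: projects_onto_def)
  have "\<forall>v\<in>carrier_vec n. row_vec_mult v M \<in> C"
    by (rule projects_onto_factorization[OF LCD M])
  then show "{v \<in> carrier_vec n. row_vec_mult v M = v} \<subseteq> C" by force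
qed

text \<open>Matching entries carry the fixed vectors of \<open>N\<close> to those of
  \<open>M\<close>, and these are the codes. Conversely, when the codes match, \<open>M\<close>
  pulled back along \<open>p\<close> projects onto \<open>C\<close>, so uniqueness makes it
  \<open>N\<close>.\<close>

lemma permuted_code_iff:
  assumes C: "LCD_code n C" and D: "LCD_code n D"
    and N: "projects_onto n N C" and M: "projects_onto n M D" and p: "p permutes {..<n}"
  shows "D = permute_vec p ` C \<longleftrightarrow> (\<forall>i<n. \<forall>j<n. M $$ (p i, p j) = N $$ (i, j))"
proof
  have Mc: "M \<in> carrier_mat n n" and Nc: "N \<in> carrier_mat n n"
    using M N by (auto simp: projects_onto_def)
  have Cc: "C \<subseteq> carrier_vec n" by (rule LCD_code_carrier[OF C])
  show "D = permute_vec p ` C" if MN: "\<forall>i<n. \<forall>j<n. M $$ (p i, p j) = N $$ (i, j)"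
  proof -
    have fixed: "row_vec_mult (permute_vec p v) M = permute_vec p v \<longleftrightarrow> row_vec_mult v N = v"
      if v: "v \<in> carrier_vec n" for v
      using row_vec_mult_permute_vec[OF p Mc Nc _ v] MN
        permute_vec_eq_iff[OF p row_vec_mult_carrier[OF Nc v] v] by simp
    have memC: "v \<in> C \<longleftrightarrow> v \<in> carrier_vec n \<and> row_vec_mult v N = v" for v
      by (subst projects_onto_fixed_vectors[OF C N]) simp
    have memD: "v \<in> D \<longleftrightarrow> v \<in> carrier_vec n \<and> row_vec_mult v M = v" for v
      by (subst projects_onto_fixed_vectors[OF D M]) simp
    show ?thesis
    proof
      show "permute_vec p ` C \<subseteq> D" using fixed by (auto simp: memC memD)
      show "D \<subseteq> permute_vec p ` C"
      proof
        fix w assume w: "w \<in> D"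
        then obtain v where "v \<in> carrier_vec n" "w = permute_vec p v"
          using permute_vec_surj[OF p] memD by blast
        then show "w \<in> permute_vec p ` C" using w fixed by (auto simp: memC memD)
      qed
    qed
  qed
  assume DC: "D = permute_vec p ` C"
  define N' where "N' = mat n n (\<lambda>(i, j). M $$ (p i, p j))"
  have N': "N' \<in> carrier_mat n n" by (simp add: N'_def)
  have mult: "row_vec_mult (permute_vec p v) M = permute_vec p (row_vec_mult v N')" if "v \<in> carrier_vec n" for v
    by (rule row_vec_mult_permute_vec[OF p Mc N' _ that]) (simp add: N'_def)
  have "row_vec_mult v N' = v" if "v \<in> C" for v
  proof -
    have v: "v \<in> carrier_vec n" using that Cc by blast
    have "permute_vec p (row_vec_mult v N') = permute_vec p v"
      using mult[OF v] M that by (simp add: projects_onto_def DC)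
    then show ?thesis using permute_vec_eq_iff[OF p row_vec_mult_carrier[OF N' v] v] by simp
  qed
  moreover have "row_vec_mult v N' = 0\<^sub>v n" if "v \<in> dual_code n C" for v
  proof -
    have v: "v \<in> carrier_vec n" using that by (simp add: dual_code_iff)
    \<comment> \<open>Coordinate permutations preserve inner products, so dual vectors move along
      with the code.\<close>
    have "permute_vec p v \<in> dual_code n D"
      using that Cc by (auto simp: dual_code_iff DC scalar_prod_permute_vec[OF p] subset_iff)
    then have "permute_vec p (row_vec_mult v N') = 0\<^sub>v n"
      using mult[OF v] M by (simp add: projects_onto_def)
    also have "0\<^sub>v n = permute_vec p (0\<^sub>v n :: bit vec)"
      using permutes_in_image[OF p] by (intro eq_permute_vecI[OF p]) auto
    finally show ?thesis using permute_vec_eq_iff[OF p row_vec_mult_carrier[OF N' v]] by simp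
  qed
  ultimately have "projects_onto n N' C" using N' by (simp add: projects_onto_def)
  then have "N' = N" using ex1_projects_onto[OF C] N by blast
  then show "\<forall>i<n. \<forall>j<n. M $$ (p i, p j) = N $$ (i, j)" by (auto simp: N'_def)
qed

section \<open>Graph isomorphisms as permutations of indices\<close>

text \<open>A digraph isomorphism carries its own maps for arcs, heads and tails. Here arcs are
  pairs with the projections as tail and head, so the arc map is the vertex map applied to both
  components.\<close>

lemma digraph_iso_with_proj_iff:
  assumes G: "pair_graph G" and H: "pair_graph H"
  shows "digraph_iso (with_proj G) (with_proj H) \<longleftrightarrow>
    (\<exists>g. bij_betw g (pverts G) (pverts H) \<and>
      (\<forall>x\<in>pverts G. \<forall>y\<in>pverts G. (g x, g y) \<in> parcs H \<longleftrightarrow> (x, y) \<in> parcs G))" (is "?L \<longleftrightarrow> ?R")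
proof
  interpret G: pair_graph G by (rule G)
  interpret H: pair_graph H by (rule H)
  {
    assume ?L
    then obtain f where f: "G.digraph_isomorphism f" and Hf: "with_proj H = app_iso f (with_proj G)"
      unfolding digraph_iso_def by blast
    define g where "g = iso_verts f"
    have V: "pverts H = g ` pverts G" using arg_cong[OF Hf, of verts] by (simp add: g_def)
    have E: "parcs H = iso_arcs f ` parcs G" using arg_cong[OF Hf, of arcs] by simp
    \<comment> \<open>Both digraphs have \<open>fst\<close> and \<open>snd\<close> as tail and head,
      so comparing these fields fixes the corresponding components of \<open>f\<close>.\<close>
    have t: "iso_tail f = fst" "iso_head f = snd"
      using arg_cong[OF Hf, of tail] arg_cong[OF Hf, of head] by simp_all
    have inj: "inj_on g (pverts G)"
      using f unfolding G.digraph_isomorphism_def g_def by blast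
    have arcs: "iso_arcs f a = (g (fst a), g (snd a))" if "a \<in> parcs G" for a
      using f that t unfolding G.digraph_isomorphism_def g_def by (simp add: prod_eq_iff)
    have mem: "x \<in> pverts G \<and> y \<in> pverts G" if "(x, y) \<in> parcs G" for x y
      using G.arc_fst_in_verts[OF that] G.arc_snd_in_verts[OF that] by simp
    have "(g x, g y) \<in> parcs H \<longleftrightarrow> (x, y) \<in> parcs G" if xy: "x \<in> pverts G" "y \<in> pverts G" for x y
    proof
      assume "(g x, g y) \<in> parcs H"
      then obtain a b where ab: "(a, b) \<in> parcs G" "g x = g a" "g y = g b" using arcs by (auto simp: E)
      then have "x = a" "y = b" using mem xy inj by (auto dest: inj_onD)
      then show "(x, y) \<in> parcs G" using ab by simp
    next
      assume "(x, y) \<in> parcs G"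
      then show "(g x, g y) \<in> parcs H" using arcs unfolding E by (metis fst_conv snd_conv image_eqI)
    qed
    then show ?R using inj V by (auto simp: bij_betw_def)
  }
  assume ?R
  then obtain g where g: "bij_betw g (pverts G) (pverts H)"
    and adj: "\<And>x y. x \<in> pverts G \<Longrightarrow> y \<in> pverts G \<Longrightarrow> (g x, g y) \<in> parcs H \<longleftrightarrow> (x, y) \<in> parcs G" by blast
  define f where "f = \<lparr>iso_verts = g, iso_arcs = map_prod g g, iso_head = snd, iso_tail = fst\<rparr>"
  have memG: "fst a \<in> pverts G" "snd a \<in> pverts G" if "a \<in> parcs G" for a
    using that G.arc_fst_in_verts G.arc_snd_in_verts by auto
  have memH: "fst a \<in> pverts H" "snd a \<in> pverts H" if "a \<in> parcs H" for a
    using that H.arc_fst_in_verts H.arc_snd_in_verts by auto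
  have inj: "inj_on g (pverts G)" and im: "g ` pverts G = pverts H" using g by (auto simp: bij_betw_def)
  have "inj_on (map_prod g g) (parcs G)"
  proof (rule inj_onI)
    fix a b assume "a \<in> parcs G" "b \<in> parcs G" "map_prod g g a = map_prod g g b"
    then show "a = b" using memG inj by (auto simp: prod_eq_iff dest: inj_onD)
  qed
  then have "G.digraph_isomorphism f"
    using inj G.wf_digraph unfolding G.digraph_isomorphism_def by (auto simp: f_def)
  moreover have "map_prod g g ` parcs G = parcs H"
  proof
    show "map_prod g g ` parcs G \<subseteq> parcs H" using adj memG by force
    show "parcs H \<subseteq> map_prod g g ` parcs G"
    proof
      fix a assume a: "a \<in> parcs H"
      obtain x y where xy: "x \<in> pverts G" "y \<in> pverts G" and "fst a = g x" "snd a = g y"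
        using memH[OF a] im by (metis imageE)
      then have "a = map_prod g g (x, y)" by (simp add: prod_eq_iff)
      then show "a \<in> map_prod g g ` parcs G" using adj[OF xy] a by auto
    qed
  qed
  then have "with_proj H = app_iso f (with_proj G)"
    using im by (simp add: app_iso_def f_def with_proj_def)
  ultimately show ?L unfolding digraph_iso_def by blast
qed

text \<open>The orderings identify vertices with indices, so vertex bijections \<open>g\<close> and
  permutations \<open>p\<close> correspond through \<open>g (vs ! i) = ws ! p i\<close>.\<close>

lemma digraph_iso_adjacency_mat_iff:
  assumes G: "pair_graph G" and H: "pair_graph H"
    and vs: "vertex_ordering G vs" "length vs = n" and ws: "vertex_ordering H ws" "length ws = n"
  shows "digraph_iso (with_proj G) (with_proj H) \<longleftrightarrow>
    (\<exists>p. p permutes {..<n} \<and> (\<forall>i<n. \<forall>j<n.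
      (adjacency_mat H ws :: 'r :: zero_neq_one mat) $$ (p i, p j) = adjacency_mat G vs $$ (i, j)))"
    (is "_ \<longleftrightarrow> ?R")
proof -
  have bv: "bij_betw ((!) vs) {..<n} (pverts G)" and bw: "bij_betw ((!) ws) {..<n} (pverts H)"
    using vs ws by (auto simp: vertex_ordering_def intro!: bij_betw_nth)
  have adj: "(\<forall>i<n. \<forall>j<n. (adjacency_mat H ws :: 'r mat) $$ (p i, p j) = adjacency_mat G vs $$ (i, j)) \<longleftrightarrow>
      (\<forall>i<n. \<forall>j<n. (ws ! p i, ws ! p j) \<in> parcs H \<longleftrightarrow> (vs ! i, vs ! j) \<in> parcs G)"
    if p: "p permutes {..<n}" for p
    using permutes_in_image[OF p] vs ws by (auto simp: adjacency_mat_def)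
  have "digraph_iso (with_proj G) (with_proj H) \<longleftrightarrow> (\<exists>p. p permutes {..<n} \<and>
      (\<forall>i<n. \<forall>j<n. (ws ! p i, ws ! p j) \<in> parcs H \<longleftrightarrow> (vs ! i, vs ! j) \<in> parcs G))"
    unfolding digraph_iso_with_proj_iff[OF G H]
  proof
    assume "\<exists>g. bij_betw g (pverts G) (pverts H) \<and>
      (\<forall>x\<in>pverts G. \<forall>y\<in>pverts G. (g x, g y) \<in> parcs H \<longleftrightarrow> (x, y) \<in> parcs G)"
    then obtain g where g: "bij_betw g (pverts G) (pverts H)"
      and adj: "\<And>x y. x \<in> pverts G \<Longrightarrow> y \<in> pverts G \<Longrightarrow> (g x, g y) \<in> parcs H \<longleftrightarrow> (x, y) \<in> parcs G" by blast
    \<comment> \<open>The identity outside \<open>{..<n}\<close> is what \<open>permutes\<close>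
      demands.\<close>
    define p where "p = (\<lambda>i. if i < n then the_inv_into {..<n} ((!) ws) (g (vs ! i)) else i)"
    have "bij_betw (the_inv_into {..<n} ((!) ws) \<circ> (g \<circ> (!) vs)) {..<n} {..<n}"
      using bv bw g by (intro bij_betw_trans bij_betw_the_inv_into)
    then have "bij_betw p {..<n} {..<n}"
      by (rule bij_betw_cong[THEN iffD1, rotated]) (auto simp: p_def)
    then have p: "p permutes {..<n}" by (rule bij_imp_permutes) (simp add: p_def)
    have mem: "vs ! i \<in> pverts G" if "i < n" for i using bv that by (auto simp: bij_betw_def)
    have "ws ! p i = g (vs ! i)" if "i < n" for i
      unfolding p_def using that g mem[OF that] f_the_inv_into_f_bij_betw[OF bw, of "g (vs ! i)"]
      by (auto dest: bij_betwE)
    then show "\<exists>p. p permutes {..<n} \<and>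
      (\<forall>i<n. \<forall>j<n. (ws ! p i, ws ! p j) \<in> parcs H \<longleftrightarrow> (vs ! i, vs ! j) \<in> parcs G)"
      using p adj mem by (intro exI[of _ p]) auto
  next
    assume "\<exists>p. p permutes {..<n} \<and>
      (\<forall>i<n. \<forall>j<n. (ws ! p i, ws ! p j) \<in> parcs H \<longleftrightarrow> (vs ! i, vs ! j) \<in> parcs G)"
    then obtain p where p: "p permutes {..<n}"
      and adj: "\<And>i j. i < n \<Longrightarrow> j < n \<Longrightarrow> (ws ! p i, ws ! p j) \<in> parcs H \<longleftrightarrow> (vs ! i, vs ! j) \<in> parcs G" by blast
    define h where "h = the_inv_into {..<n} ((!) vs)"
    have h: "bij_betw h (pverts G) {..<n}" unfolding h_def by (rule bij_betw_the_inv_into[OF bv])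
    have hx: "h x < n" "vs ! h x = x" if "x \<in> pverts G" for x
      using that h f_the_inv_into_f_bij_betw[OF bv, of x] by (auto simp: h_def dest: bij_betwE)
    have "bij_betw ((!) ws \<circ> (p \<circ> h)) (pverts G) (pverts H)"
      by (intro bij_betw_trans[OF bij_betw_trans[OF h permutes_imp_bij[OF p]] bw])
    moreover have "\<forall>x\<in>pverts G. \<forall>y\<in>pverts G. (((!) ws \<circ> (p \<circ> h)) x, ((!) ws \<circ> (p \<circ> h)) y) \<in> parcs H \<longleftrightarrow> (x, y) \<in> parcs G"
      using adj hx by simp
    ultimately show "\<exists>g. bij_betw g (pverts G) (pverts H) \<and>
      (\<forall>x\<in>pverts G. \<forall>y\<in>pverts G. (g x, g y) \<in> parcs H \<longleftrightarrow> (x, y) \<in> parcs G)" by blast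
  qed
  then show ?thesis using adj by metis
qed

theorem theorem5p2:
  fixes q :: nat
  assumes "primepow q" and "q mod 4 = 1"
  shows "(\<forall>(G :: 'a pair_pre_digraph) vs.
            conference_graph q G \<and> vertex_ordering G vs \<longrightarrow>
              (yields_even_LCD_code G vs \<longleftrightarrow> q mod 8 = 1)) \<and>
         (q mod 8 = 1 \<longrightarrow>
            (\<forall>(G :: 'a pair_pre_digraph) vs C.
               conference_graph q G \<and> vertex_ordering G vs \<and> yields_code G vs C \<longrightarrow>
                 binary_code q C \<and> code_dim q C = (q - 1) div 2) \<and>
            (\<forall>(G :: 'a pair_pre_digraph) vs C (H :: 'b pair_pre_digraph) ws D.
               conference_graph q G \<and> vertex_ordering G vs \<and> yields_code G vs C \<and>
               conference_graph q H \<and> vertex_ordering H ws \<and> yields_code H ws D \<longrightarrow>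
                 (permutation_equivalent q C D \<longleftrightarrow>
                  digraph_iso (with_proj G) (with_proj H))))"
proof -
  define m where "m = q div 4"
  have q: "q = 4 * m + 1" using assms(2) by (simp add: m_def) presburger
  have mod8: "q mod 8 = 1 \<longleftrightarrow> even m" unfolding q by presburger
  show ?thesis
  proof (intro conjI allI impI; (elim conjE)?)
    fix G :: "'a pair_pre_digraph" and vs
    assume G: "conference_graph q G" and vs: "vertex_ordering G vs"
    show "yields_even_LCD_code G vs \<longleftrightarrow> q mod 8 = 1"
      unfolding mod8
      using yields_even_LCD_code_if_even[OF G[unfolded q] vs] even_if_yields_code[OF G[unfolded q] vs]
      by (auto simp: yields_even_LCD_code_def)
  next
    fix G :: "'a pair_pre_digraph" and vs C
    assume even: "q mod 8 = 1" and G: "conference_graph q G" and vs: "vertex_ordering G vs"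
      and C: "yields_code G vs C"
    have len: "length vs = q" by (rule vertex_ordering_length[OF G vs])
    show "binary_code q C" using C len by (simp add: yields_code_def LCD_code_def)
    show "code_dim q C = (q - 1) div 2"
      using code_dim_yields_code[OF G[unfolded q] vs even[unfolded mod8] C] len q by simp
  next
    fix G :: "'a pair_pre_digraph" and vs C and H :: "'b pair_pre_digraph" and ws D
    assume "q mod 8 = 1" and G: "conference_graph q G" "vertex_ordering G vs" and C: "yields_code G vs C"
      and H: "conference_graph q H" "vertex_ordering H ws" and D: "yields_code H ws D"
    have len: "length vs = q" "length ws = q" using vertex_ordering_length G H by blast+
    have LC: "LCD_code q C" and LD: "LCD_code q D" using C D len by (auto simp: yields_code_def)
    have "projects_onto q (adjacency_mat G vs) C" "projects_onto q (adjacency_mat H ws) D"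
      using C D len projects_onto_orthogonal_projector by (auto simp: yields_code_def)
    \<comment> \<open>The projectors of the two codes are the adjacency matrices, so permutation
      equivalence and isomorphism both reduce to a permutation \<open>p\<close> matching their
      entries.\<close>
    note permuted_code_iff[OF LC LD this]
    moreover have "pair_graph G" "pair_graph H"
      using G H by (auto simp: conference_graph_def strongly_regular_graph_def)
    note digraph_iso_adjacency_mat_iff[OF this G(2) len(1) H(2) len(2), where 'r = bit]
    ultimately show "permutation_equivalent q C D \<longleftrightarrow> digraph_iso (with_proj G) (with_proj H)"
      unfolding permutation_equivalent_iff[OF LCD_code_carrier[OF LC]] by blast
  qed
qed

end
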